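(* Let $(\Omega,\rightarrow)$ be a finite (nonempty) associative semigroup of cardinality $\omega$, and let $\mathbf{As}_\Omega^2$ be the nonsymmetric operad of two-parameters $\Omega$-associative algebras. Then $\mathbf{As}_\Omega^2$ is Koszul. Moreover, put $p_n=\dim_{\mathbb{K}}(\mathbf{As}_\Omega^2(n))$ for $n\geqslant 1$ and $P(X)=\sum_{n=1}^\infty p_nX^n\in\mathbb{Q}[[X]]$. Then $p_1=1$ and, for any $n\geqslant 2$, $$p_n=\omega(\omega-1)\sum_{k=1}^{n-1}p_kp_{n-k}+\omega p_{n-1},$$ or equivalently, if $\omega\geqslant 2$, $$P(X)=\frac{1-\omega X-\sqrt{1+2\omega(1-2\omega)X+\omega^2X^2}}{2\omega(\omega-1)}.$$
   Context: $\mathbb{K}$ is a commutative field; operads are operads in $\mathbb{K}$-vector spaces. For a semigroup $(\Omega,\rightarrow)$, $\mathbf{As}_\Omega^2$ is the nonsymmetric operad generated by binary operations $*_{\alpha,\beta}$ (linearly independent, $(\alpha,\beta)\in\Omega^2$) with the relations, for all $\alpha,\beta,\gamma\in\Omega$, $$*_{\alpha\rightarrow\beta,\gamma}\circ_1 *_{\alpha,\beta}=*_{\alpha,\beta\rightarrow\gamma}\circ_2 *_{\beta,\gamma}.$$ Its algebras (two-parameters $\Omega$-associative algebras) are vector spaces $V$ with bilinear products $*_{\alpha,\beta}$ such that $(x*_{\alpha,\beta}y)*_{\alpha\rightarrow\beta,\gamma}z=x*_{\alpha,\beta\rightarrow\gamma}(y*_{\beta,\gamma}z)$ for all $x,y,z\in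 V$ and $\alpha,\beta,\gamma\in\Omega$. *)

theory Defs
  imports
    "HOL-Library.Tree"
    "HOL-Library.Poly_Mapping"
    "HOL-Computational_Algebra.Formal_Power_Series"
begin

section \<open>Free vector spaces\<close>

text \<open>The vector space with basis \<^typ>\<open>'b\<close> over the field \<^typ>\<open>'k\<close> is the type of finitely
  supported functions from \<^typ>\<open>'b\<close> to \<^typ>\<open>'k\<close>.\<close>

abbreviation "lookup \<equiv> Poly_Mapping.lookup"
abbreviation "keys \<equiv> Poly_Mapping.keys"

definition vscale :: "'k::field \<Rightarrow> ('b \<Rightarrow>\<^sub>0 'k) \<Rightarrow> ('b \<Rightarrow>\<^sub>0 'k)" where
  "vscale c x = Poly_Mapping.map ((*) c) x"

lemma lookup_vscale [simp]: "lookup (vscale c x) b = c * lookup x b"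
  unfolding vscale_def by transfer (simp add: when_def)

global_interpretation fv: vector_space "vscale :: 'k::field \<Rightarrow> ('b \<Rightarrow>\<^sub>0 'k) \<Rightarrow> ('b \<Rightarrow>\<^sub>0 'k)"
  by standard (auto intro!: poly_mapping_eqI simp: lookup_add algebra_simps)

text \<open>\<^term>\<open>B\<close> is a set of representatives of a basis of the quotient space \<open>V/W\<close>;
  the dimension is the cardinality of such a set (0 in the infinite-dimensional case, as for
  the library's \<open>dim\<close>).\<close>

definition quot_basis ::
    "('b \<Rightarrow>\<^sub>0 'k::field) set \<Rightarrow> ('b \<Rightarrow>\<^sub>0 'k) set \<Rightarrow> ('b \<Rightarrow>\<^sub>0 'k) set \<Rightarrow> bool" where
  "quot_basis V W B \<longleftrightarrow> B \<subseteq> V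
     \<and> (\<forall>S c. finite S \<and> S \<subseteq> B \<and> (\<Sum>b\<in>S. vscale (c b) b) \<in> W \<longrightarrow> (\<forall>b\<in>S. c b = 0))
     \<and> V \<subseteq> fv.span (B \<union> W)"

definition quot_dim :: "('b \<Rightarrow>\<^sub>0 'k::field) set \<Rightarrow> ('b \<Rightarrow>\<^sub>0 'k) set \<Rightarrow> nat" where
  "quot_dim V W = card (SOME B. quot_basis V W B)"

section \<open>The free nonsymmetric operad on binary generators\<close>

text \<open>Let \<open>E\<close> be the vector space with basis \<^typ>\<open>'e\<close>, placed in arity 2.  The free
  nonsymmetric operad \<open>T(E)\<close> has as basis in arity \<open>n\<close> the planar binary trees with \<open>n\<close>
  leaves whose internal vertices are labelled by \<^typ>\<open>'e\<close>.  Note that \<^const>\<open>size1\<close> counts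
  leaves and \<^const>\<open>size\<close> counts internal vertices.\<close>

definition free_op :: "nat \<Rightarrow> ('e tree \<Rightarrow>\<^sub>0 'k::field) set" where
  "free_op n = {x. \<forall>t\<in>keys x. size1 t = n}"

definition corolla :: "'e \<Rightarrow> 'e tree" where
  "corolla e = \<langle>\<langle>\<rangle>, e, \<langle>\<rangle>\<rangle>"

definition gen :: "'e \<Rightarrow> ('e tree \<Rightarrow>\<^sub>0 'k::field)" where
  "gen e = Poly_Mapping.single (corolla e) 1"

text \<open>\<open>graft s i t\<close> plugs the root of \<open>t\<close> into the \<open>i\<close>-th leaf of \<open>s\<close>; the leaves are numbered
  \<open>1, \<dots>, size1 s\<close> from left to right and only indices in this range are used.\<close>

fun graft :: "'e tree \<Rightarrow> nat \<Rightarrow> 'e tree \<Rightarrow> 'e tree" where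
  "graft \<langle>\<rangle> i t = t"
| "graft \<langle>l, e, r\<rangle> i t =
     (if i \<le> size1 l then \<langle>graft l i t, e, r\<rangle> else \<langle>l, e, graft r (i - size1 l) t\<rangle>)"

definition pcomp :: "('e tree \<Rightarrow>\<^sub>0 'k::field) \<Rightarrow> nat \<Rightarrow> ('e tree \<Rightarrow>\<^sub>0 'k) \<Rightarrow> ('e tree \<Rightarrow>\<^sub>0 'k)" where
  "pcomp x i y = (\<Sum>s\<in>keys x. \<Sum>t\<in>keys y.
     Poly_Mapping.single (graft s i t) (lookup x s * lookup y t))"

section \<open>Binary quadratic operads\<close>

definition operadic_ideal :: "(nat \<Rightarrow> ('e tree \<Rightarrow>\<^sub>0 'k::field) set) \<Rightarrow> bool" where
  "operadic_ideal I \<longleftrightarrow>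
     (\<forall>n. fv.subspace (I n) \<and> I n \<subseteq> free_op n) \<and>
     (\<forall>m n i x y. 1 \<le> i \<and> i \<le> m \<and> x \<in> free_op m \<and> y \<in> free_op n \<and> (x \<in> I m \<or> y \<in> I n)
        \<longrightarrow> pcomp x i y \<in> I (m + n - 1))"

text \<open>For a set \<open>R\<close> of quadratic relations, i.e. of elements of \<open>T(E)(3)\<close>, the ideal \<open>(R)\<close>.  The
  operad \<open>P(E,R)\<close> generated by \<open>E\<close> with relations \<open>R\<close> is the quotient \<open>T(E)/(R)\<close>.\<close>

definition rel_ideal ::
    "('e tree \<Rightarrow>\<^sub>0 'k::field) set \<Rightarrow> nat \<Rightarrow> ('e tree \<Rightarrow>\<^sub>0 'k) set" where
  "rel_ideal R n = (\<Inter>I\<in>{I. operadic_ideal I \<and> R \<subseteq> I 3}. I n)"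

definition operad_dim :: "('e tree \<Rightarrow>\<^sub>0 'k::field) set \<Rightarrow> nat \<Rightarrow> nat" where
  "operad_dim R n = quot_dim (free_op n) (rel_ideal R n)"

section \<open>The Koszul dual cooperad\<close>

text \<open>The cofree conilpotent cooperad \<open>T\<^sup>c(sE)\<close> on the suspension of \<open>E\<close> has the same underlying
  spaces; its element represented by the tree \<open>t\<close>, whose vertices read from left to right in
  prefix order (root, left subtree, right subtree) carry \<open>e\<^sub>1, \<dots>, e\<^sub>w\<close>, is the tree monomial on
  \<open>se\<^sub>1 \<otimes> \<dots> \<otimes> se\<^sub>w\<close>, of degree \<open>w\<close>.  The Koszul sign rule for this ordering gives
  \<open>s \<circ>\<^sub>i t = (-1)\<^sup>(after s i * size t) graft s i t\<close>,
  where \<open>after s i\<close> is the number of vertices of \<open>s\<close> that follow its \<open>i\<close>-th leaf in prefix order.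
  Dually the same sign appears in the partial decompositions.\<close>

fun after :: "'e tree \<Rightarrow> nat \<Rightarrow> nat" where
  "after \<langle>\<rangle> i = 0"
| "after \<langle>l, e, r\<rangle> i = (if i \<le> size1 l then after l i + size r else after r (i - size1 l))"

definition tensor2 ::
    "('a \<Rightarrow>\<^sub>0 'k::field) \<Rightarrow> ('b \<Rightarrow>\<^sub>0 'k) \<Rightarrow> ('a \<times> 'b \<Rightarrow>\<^sub>0 'k)" where
  "tensor2 x y = (\<Sum>s\<in>keys x. \<Sum>t\<in>keys y. Poly_Mapping.single (s, t) (lookup x s * lookup y t))"

text \<open>A sub-cooperad of \<open>T\<^sup>c(sE)\<close>: every partial decomposition
  \<open>\<Delta>\<^sub>i : T\<^sup>c(sE)(m + n - 1) \<rightarrow> T\<^sup>c(sE)(m) \<otimes> T\<^sup>c(sE)(n)\<close> (the component dual to \<open>\<circ>\<^sub>i\<close>)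
  sends \<open>C (m + n - 1)\<close> to \<open>C m \<otimes> C n\<close>.  Here \<open>z\<close> is \<open>\<Delta>\<^sub>i x\<close>.\<close>

definition sub_cooperad :: "(nat \<Rightarrow> ('e tree \<Rightarrow>\<^sub>0 'k::field) set) \<Rightarrow> bool" where
  "sub_cooperad C \<longleftrightarrow>
     (\<forall>n. fv.subspace (C n) \<and> C n \<subseteq> free_op n) \<and>
     (\<forall>m n i x. 1 \<le> i \<and> i \<le> m \<and> 1 \<le> n \<and> x \<in> C (m + n - 1) \<longrightarrow>
        (\<exists>z \<in> fv.span {tensor2 a b | a b. a \<in> C m \<and> b \<in> C n}.
           \<forall>s t. size1 s = m \<and> size1 t = n \<longrightarrow>
             lookup z (s, t) = (-1) ^ (after s i * size t) * lookup x (graft s i t)))"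

text \<open>The Koszul dual cooperad \<open>P\<^sup>\<exclamdown> = C(sE, s\<^sup>2R)\<close>: the largest sub-cooperad of
  \<open>T\<^sup>c(sE)\<close> whose part of weight 2, that is of arity 3, lies in the span of \<open>s\<^sup>2R\<close>.  A tree with
  two vertices is a grafting of one corolla on another with \<open>after = 0\<close>, so \<open>s\<^sup>2\<close> acts on
  coordinates as the identity up to a global sign.\<close>

definition koszul_dual ::
    "('e tree \<Rightarrow>\<^sub>0 'k::field) set \<Rightarrow> nat \<Rightarrow> ('e tree \<Rightarrow>\<^sub>0 'k) set" where
  "koszul_dual R n = (\<Union>C\<in>{C. sub_cooperad C \<and> C 3 \<subseteq> fv.span R}. C n)"

section \<open>The Koszul complex\<close>

text \<open>A pair \<open>(c, [f\<^sub>1, \<dots>, f\<^sub>k])\<close> with \<open>size1 c = k\<close> stands for the basis element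
  \<open>c \<otimes> f\<^sub>1 \<otimes> \<dots> \<otimes> f\<^sub>k\<close> of \<open>T\<^sup>c(sE) \<circ> T(E)\<close>, of degree \<open>size c = k - 1\<close>.  The part
  \<open>P\<^sup>\<exclamdown>(k) \<otimes> (\<Oplus> P(n\<^sub>1) \<otimes> \<dots> \<otimes> P(n\<^sub>k))\<close>, \<open>n\<^sub>1 + \<dots> + n\<^sub>k = n\<close>, of \<open>P\<^sup>\<exclamdown> \<circ> P\<close>
  in arity \<open>n\<close> is represented as the quotient \<open>kos_chain R k n / kos_null R k n\<close>: the tensors over
  the \<open>T(E)(n\<^sub>j)\<close> modulo those having a factor in the ideal.\<close>

definition tensors ::
    "('e tree \<Rightarrow>\<^sub>0 'k::field) \<Rightarrow> ('e tree \<Rightarrow>\<^sub>0 'k) list \<Rightarrow> ('e tree \<times> 'e tree list \<Rightarrow>\<^sub>0 'k)" where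
  "tensors x ys = (\<Sum>c\<in>keys x. \<Sum>fs\<in>listset (map keys ys).
     Poly_Mapping.single (c, fs) (lookup x c * prod_list (map2 lookup ys fs)))"

definition kos_chain ::
    "('e tree \<Rightarrow>\<^sub>0 'k::field) set \<Rightarrow> nat \<Rightarrow> nat \<Rightarrow> ('e tree \<times> 'e tree list \<Rightarrow>\<^sub>0 'k) set" where
  "kos_chain R k n = fv.span {tensors x ys | x ys ns.
     x \<in> koszul_dual R k \<and> length ns = k \<and> sum_list ns = n \<and>
     list_all2 (\<lambda>y m. y \<in> free_op m) ys ns}"

definition kos_null ::
    "('e tree \<Rightarrow>\<^sub>0 'k::field) set \<Rightarrow> nat \<Rightarrow> nat \<Rightarrow> ('e tree \<times> 'e tree list \<Rightarrow>\<^sub>0 'k) set" where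
  "kos_null R k n = fv.span {tensors x ys | x ys ns.
     x \<in> koszul_dual R k \<and> length ns = k \<and> sum_list ns = n \<and>
     list_all2 (\<lambda>y m. y \<in> free_op m) ys ns \<and> (\<exists>j<k. ys ! j \<in> rel_ideal R (ns ! j))}"

text \<open>The differential is induced by the twisting morphism \<open>\<kappa> : P\<^sup>\<exclamdown> \<rightarrow> sE \<rightarrow> E \<rightarrow> P\<close> of degree
  \<open>-1\<close>: split a generator \<open>e\<close> off the top of \<open>c = c' \<circ>\<^sub>i se\<close>, apply \<open>\<kappa>\<close> to it (which produces the
  sign \<open>(-1)\<^sup>(size c')\<close> as \<open>\<kappa>\<close> moves past \<open>c'\<close>), and compose \<open>e\<close> in the operad with the two
  entries grafted on it.  The second sign is that of the partial decomposition.\<close>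

definition top_splits :: "'e tree \<Rightarrow> ('e tree \<times> nat \<times> 'e) set" where
  "top_splits c = {(c', i, e). 1 \<le> i \<and> i \<le> size1 c' \<and> graft c' i (corolla e) = c}"

definition kos_diff ::
    "('e tree \<times> 'e tree list \<Rightarrow>\<^sub>0 'k::field) \<Rightarrow> ('e tree \<times> 'e tree list \<Rightarrow>\<^sub>0 'k)" where
  "kos_diff z = (\<Sum>(c, fs)\<in>keys z. \<Sum>(c', i, e)\<in>top_splits c.
     Poly_Mapping.single
       (c', take (i - 1) fs @ \<langle>fs ! (i - 1), e, fs ! i\<rangle> # drop (i + 1) fs)
       ((-1) ^ size c' * (-1) ^ after c' i * lookup z (c, fs)))"

text \<open>The operad \<open>P(E,R)\<close> is Koszul if its Koszul complex \<open>P\<^sup>\<exclamdown> \<circ>\<^sub>\<kappa> P\<close> is acyclic, i.e. has homology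
  the unit operad \<open>I\<close>.  In arity 1 the complex is \<open>I(1)\<close>, concentrated in degree 0,
  so the condition is that in every arity \<open>n \<ge> 2\<close> cycles and boundaries agree in each degree
  \<open>k - 1\<close>; both are written as subspaces of \<open>kos_chain R k n\<close> containing \<open>kos_null R k n\<close>.\<close>

definition koszul :: "('e tree \<Rightarrow>\<^sub>0 'k::field) set \<Rightarrow> bool" where
  "koszul R \<longleftrightarrow> (\<forall>n\<ge>2. \<forall>k\<ge>1.
     {z \<in> kos_chain R k n. kos_diff z \<in> kos_null R (k - 1) n} =
     {kos_diff y + w | y w. y \<in> kos_chain R (k + 1) n \<and> w \<in> kos_null R k n})"

section \<open>Two-parameters \<open>\<Omega>\<close>-associative algebras\<close>

text \<open>The generator \<open>*\<^sub>\<alpha>\<^sub>,\<^sub>\<beta>\<close> is \<open>gen (\<alpha>, \<beta>)\<close>; \<open>arr\<close> is the product \<open>\<rightarrow>\<close> of \<open>\<Omega>\<close>.\<close>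

definition As2_rels :: "('w \<Rightarrow> 'w \<Rightarrow> 'w) \<Rightarrow> (('w \<times> 'w) tree \<Rightarrow>\<^sub>0 'k::field) set" where
  "As2_rels arr = {pcomp (gen (arr \<alpha> \<beta>, \<gamma>)) 1 (gen (\<alpha>, \<beta>))
                   - pcomp (gen (\<alpha>, arr \<beta> \<gamma>)) 2 (gen (\<beta>, \<gamma>)) | \<alpha> \<beta> \<gamma>. True}"

section \<open>Square roots of power series\<close>

text \<open>The square root with constant coefficient 1 of a power series with constant coefficient 1.\<close>

definition fps_sqrt :: "'a::field_char_0 fps \<Rightarrow> 'a fps" where
  "fps_sqrt = fps_radical (\<lambda>_ _. 1) 2"

lemma fps_sqrt_power2:
  assumes "fps_nth a 0 = 1"
  shows "fps_sqrt a ^ 2 = a"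
  using power_radical[of a "\<lambda>_ _. 1" 1] assms by (simp add: fps_sqrt_def numeral_2_eq_2)

lemma fps_sqrt_nth_0: "fps_nth (fps_sqrt a) 0 = 1"
  by (simp add: fps_sqrt_def)

section \<open>Consistency checks\<close>

lemma size1_graft: "1 \<le> i \<Longrightarrow> i \<le> size1 s \<Longrightarrow> size1 (graft s i t) = size1 s + size1 t - 1"
proof (induction s i t rule: graft.induct)
  case (2 l e r i t)
  have "size1 t > 0" "size1 l > 0" "size1 r > 0" by simp_all
  then show ?case using 2 by auto
qed auto

lemma graft_corolla_neq_Leaf: "graft s i \<langle>\<langle>\<rangle>, e, \<langle>\<rangle>\<rangle> \<noteq> \<langle>\<rangle>"
  by (cases s) auto

lemma finite_top_splits: "finite (top_splits c)"
proof -
  define f where "f = (\<lambda>(c', i, e :: 'a). graft c' i (corolla e))"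
  have inj: "c' = c'' \<and> e = e'"
    if "1 \<le> i" "i \<le> size1 c'" "i \<le> size1 c''" "graft c' i (corolla e) = graft c'' i (corolla e')"
    for c' c'' :: "'a tree" and i e e'
    using that
  proof (induction c' arbitrary: c'' i)
    case Leaf
    then show ?case
      by (cases c'') (auto simp: corolla_def graft_corolla_neq_Leaf graft_corolla_neq_Leaf[symmetric]
          size1_size split: if_splits)
  next
    case (Node l a r)
    show ?case
    proof (cases c'')
      case Leaf
      with Node.prems have "i = 1" by auto
      with Leaf Node.prems show ?thesis
        by (auto simp: corolla_def graft_corolla_neq_Leaf size1_size split: if_splits)
    next
      case (Node l' a' r')
      have *: "size1 (corolla e) = 2" "size1 (corolla e') = 2" by (simp_all add: corolla_def)
      have "i \<le> size1 l \<longleftrightarrow> i \<le> size1 l'"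
        using Node Node.prems * size1_graft[of i l "corolla e"] size1_graft[of i l' "corolla e'"]
        by (auto split: if_splits)
      moreover have "size1 l = size1 l'" if "i > size1 l" "i > size1 l'"
        using Node Node.prems that by auto
      ultimately show ?thesis
        using Node.IH(1)[of i l'] Node.IH(2)[of "i - size1 l" r'] Node Node.prems
        by (auto split: if_splits)
    qed
  qed
  have size: "1 \<le> i \<and> i \<le> size1 c" if "(c', i, e) \<in> top_splits c" for c' i e
    using that size1_graft[of i c' "corolla e"] by (auto simp: top_splits_def corolla_def)
  have "inj_on (\<lambda>(c', i, e). i) (top_splits c)"
    unfolding inj_on_def top_splits_def by (clarsimp, metis One_nat_def inj)
  moreover have "(\<lambda>(c', i, e). i) ` top_splits c \<subseteq> {1..size1 c}"
    using size by auto
  ultimately show ?thesis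
    by (meson finite_atLeastAtMost finite_imageD finite_subset)
qed

end

(* A coherently labelled tree (the label of each vertex being the pair of the products of the leaf
words of its two subtrees) is determined by its shape and its leaf word, and the Koszul dual
cooperad is spanned in arity n by the signed sums of all shapes with a fixed leaf word of length
n. Oriented from left combs to right combs, the relations form a confluent rewriting system, so
the operad is linearised from its normal forms, and the recursion counts these. Two-parameters
associativity means that the trees tensored with the semigroup algebra of Omega form an
associative algebra. Its bar complex is the Koszul complex, up to forgetting Omega in degree 0; it
is acyclic because this algebra is free. *)

theory Submission
  imports Defs
begin

section \<open>Linear extension\<close>

text \<open>The signs come from reordering vertices. The cooperad uses prefix order;
  \<open>tsign\<close> compares it with right-to-left infix order, in which the vertices are the
  gaps between consecutive leaves, so that the only sign left in a decomposition of a signed sum is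
  \<open>(-1) ^ ((i - 1) * (n - 1))\<close>. Maximality of the cooperad requires joining any two
  shapes by changes visible inside a factor of a proper partial decomposition. This is impossible
  with two vertices, where the relations decide, and possible from three vertices on. Confluence is
  obtained without critical pairs: the product \<open>mul\<close> satisfies two-parameters
  associativity, so normalisation is compatible with grafting and its kernel is an operadic ideal.
  The obstacle in the complex is that the trivial tree carries no label. Hence \<open>emb\<close> is
  injective only on lists of length at least 2, and the contracting homotopy, defined on lists, has
  to be independent of the letter of a single entry in order to make sense on chains.\<close>

definition lin :: "('a \<Rightarrow> ('b \<Rightarrow>\<^sub>0 'k::field)) \<Rightarrow> ('a \<Rightarrow>\<^sub>0 'k) \<Rightarrow> ('b \<Rightarrow>\<^sub>0 'k)" where
  "lin f z = (\<Sum>a\<in>keys z. vscale (lookup z a) (f a))"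

abbreviation sng :: "'a \<Rightarrow> ('a \<Rightarrow>\<^sub>0 'k::field)" where
  "sng a \<equiv> Poly_Mapping.single a 1"

lemma lin_superset:
  assumes "finite A" "keys z \<subseteq> A"
  shows "lin f z = (\<Sum>a\<in>A. vscale (lookup z a) (f a))"
  unfolding lin_def by (rule sum.mono_neutral_left) (use assms in \<open>auto simp: in_keys_iff\<close>)

lemma lin_add: "lin f (x + y) = lin f x + lin f y"
proof -
  let ?A = "keys x \<union> keys y"
  have "keys (x + y) \<subseteq> ?A" by (rule Poly_Mapping.keys_add)
  then show ?thesis
    by (simp add: lin_superset[of ?A] lookup_add fv.scale_left_distrib sum.distrib)
qed

lemma lin_scale: "lin f (vscale c x) = vscale c (lin f x)"
proof -
  have "keys (vscale c x) \<subseteq> keys x" by (auto simp: in_keys_iff)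
  then show ?thesis
    by (simp add: lin_superset[of "keys x"] fv.scale_sum_right)
qed

lemma module_hom_lin: "module_hom vscale vscale (lin f)"
  by unfold_locales (simp_all add: lin_add lin_scale)

lemma lin_zero [simp]: "lin f 0 = 0"
  and lin_minus: "lin f (x - y) = lin f x - lin f y"
  and lin_sum: "lin f (sum g A) = (\<Sum>a\<in>A. lin f (g a))"
  by (fact module_hom.zero[OF module_hom_lin] module_hom.diff[OF module_hom_lin]
      module_hom.sum[OF module_hom_lin])+

lemma lin_single [simp]: "lin f (Poly_Mapping.single a c) = vscale c (f a)"
  by (simp add: lin_superset[of "{a}"])

lemma lin_lin: "lin f (lin g z) = lin (\<lambda>a. lin f (g a)) z"
  unfolding lin_def[of g] lin_def[of "\<lambda>a. lin f (g a)"] by (simp add: lin_sum lin_scale)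

lemma lin_cong: "(\<And>a. a \<in> keys z \<Longrightarrow> f a = g a) \<Longrightarrow> lin f z = lin g z"
  unfolding lin_def by (rule sum.cong) auto

lemma vscale_single [simp]: "vscale c (Poly_Mapping.single a d) = Poly_Mapping.single a (c * d)"
  by (rule poly_mapping_eqI) (simp add: lookup_single when_def)

lemma lin_sng [simp]: "lin sng z = z"
proof (rule poly_mapping_eqI)
  fix b
  have "lookup (lin sng z) b = (\<Sum>a\<in>keys z. if a = b then lookup z a else 0)"
    unfolding lin_def lookup_sum by (rule sum.cong) (auto simp: lookup_single when_def)
  also have "\<dots> = lookup z b" by (simp add: in_keys_iff)
  finally show "lookup (lin sng z) b = lookup z b" .
qed

lemma lin_diff_fun: "lin (\<lambda>a. f a - g a) z = lin f z - lin g z"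
  and lin_add_fun: "lin (\<lambda>a. f a + g a) z = lin f z + lin g z"
  and lin_scale_fun: "lin (\<lambda>a. vscale c (f a)) z = vscale c (lin f z)"
  unfolding lin_def
  by (simp_all add: fv.scale_right_diff_distrib fv.scale_right_distrib sum_subtractf sum.distrib
      fv.scale_sum_right mult.commute)

lemma lin_zero_fun: "(\<And>a. a \<in> keys z \<Longrightarrow> f a = 0) \<Longrightarrow> lin f z = 0"
  unfolding lin_def by simp

lemma lookup_lin: "lookup (lin f z) b = (\<Sum>a\<in>keys z. lookup z a * lookup (f a) b)"
  by (simp add: lin_def lookup_sum)

lemma keys_lin: "keys (lin f z) \<subseteq> (\<Union>a\<in>keys z. keys (f a))"
proof
  fix b assume "b \<in> keys (lin f z)"
  then have "(\<Sum>a\<in>keys z. lookup z a * lookup (f a) b) \<noteq> 0"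
    by (simp add: in_keys_iff lookup_lin)
  then obtain a where "a \<in> keys z" "lookup z a * lookup (f a) b \<noteq> 0"
    by (rule sum.not_neutral_contains_not_neutral)
  then show "b \<in> (\<Union>a\<in>keys z. keys (f a))" by (auto simp: in_keys_iff)
qed

lemma lin_in_subspace: "fv.subspace S \<Longrightarrow> (\<And>a. a \<in> keys z \<Longrightarrow> f a \<in> S) \<Longrightarrow> lin f z \<in> S"
  unfolding lin_def by (intro fv.subspace_sum fv.subspace_scale)

text \<open>Chains are handled through formal combinations of indices, so that maps can be computed
  on indices even where \<open>f\<close> identifies some of them.\<close>

lemma span_image_eq_lin:
  fixes f :: "'a \<Rightarrow> ('b \<Rightarrow>\<^sub>0 'k::field)"
  shows "fv.span (f ` A) = {lin f z | z. keys z \<subseteq> A}"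
proof -
  have "x \<in> {lin f z | z. keys z \<subseteq> A}" if "x \<in> fv.span (f ` A)" for x
    using that
  proof (induction rule: fv.span_induct_alt)
    case base
    show ?case by (auto intro!: exI[of _ 0])
  next
    case (step c x y)
    then obtain a z where *: "x = f a" "a \<in> A" "y = lin f z" "keys z \<subseteq> A" by auto
    have "keys (Poly_Mapping.single a c + z) \<subseteq> A"
      using Poly_Mapping.keys_add[of "Poly_Mapping.single a c" z] *
      by (auto split: if_splits)
    then show ?case using * by (auto intro!: exI[of _ "Poly_Mapping.single a c + z"] simp: lin_add)
  qed
  moreover have "lin f z \<in> fv.span (f ` A)" if "keys z \<subseteq> A" for z
    using that by (intro lin_in_subspace) (auto intro: fv.span_base)
  ultimately show ?thesis by blast
qed

lemma subspace_free_op: "fv.subspace (free_op n :: ('e tree \<Rightarrow>\<^sub>0 'k::field) set)"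
proof (rule fv.subspaceI)
  show "x + y \<in> free_op n" if "x \<in> free_op n" "y \<in> free_op n" for x y :: "'e tree \<Rightarrow>\<^sub>0 'k"
    using that Poly_Mapping.keys_add[of x y] unfolding free_op_def by blast
qed (auto simp: free_op_def in_keys_iff)

section \<open>Dimension of a quotient by a kernel\<close>

lemma independent_sng: "fv.independent (sng ` N :: ('b \<Rightarrow>\<^sub>0 'k::field) set)"
  unfolding fv.independent_explicit_module
proof safe
  fix T :: "('b \<Rightarrow>\<^sub>0 'k) set" and u v
  assume T: "finite T" "T \<subseteq> sng ` N" "(\<Sum>v\<in>T. vscale (u v) v) = 0" "v \<in> T"
  then obtain a where a: "v = sng a" by blast
  have "(\<Sum>v\<in>T. u v * lookup v a) = 0"
    using arg_cong[OF T(3), of "\<lambda>x. lookup x a"] by (simp add: lookup_sum)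
  moreover have "u w * lookup w a = (if w = v then u v else 0)" if "w \<in> T" for w
    using that T(2) a by (auto simp: lookup_single when_def split: if_splits)
  ultimately show "u v = 0" using T(1,4) by simp
qed

text \<open>\<open>quot_dim\<close> uses an arbitrarily chosen quotient basis. When the subspace is
  the kernel of a linear map, any such basis is carried injectively to a basis of the image, so the
  choice does not matter.\<close>

lemma quot_basis_card:
  fixes f :: "'a \<Rightarrow> ('b \<Rightarrow>\<^sub>0 'k::field)"
  assumes N: "finite N" and B: "quot_basis V {x \<in> V. lin f x = 0} B"
    and V: "fv.subspace V" and im: "lin f ` V = fv.span (sng ` N)"
  shows "card B = card N"
proof -
  let ?W = "{x \<in> V. lin f x = 0}"
  from B have BV: "B \<subseteq> V" and sp: "V \<subseteq> fv.span (B \<union> ?W)"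
    and ind: "\<And>S c. finite S \<Longrightarrow> S \<subseteq> B \<Longrightarrow> (\<Sum>b\<in>S. vscale (c b) b) \<in> ?W \<Longrightarrow> \<forall>b\<in>S. c b = 0"
    unfolding quot_basis_def by blast+
  have ind': "\<forall>b\<in>S. c b = 0"
    if "finite S" "S \<subseteq> B" "lin f (\<Sum>b\<in>S. vscale (c b) b) = 0" for S c
  proof (rule ind[OF that(1,2)])
    have "(\<Sum>b\<in>S. vscale (c b) b) \<in> V"
      using that(2) BV by (intro fv.subspace_sum fv.subspace_scale V) blast
    then show "(\<Sum>b\<in>S. vscale (c b) b) \<in> ?W" using that(3) by simp
  qed
  have inj: "inj_on (lin f) B"
  proof (rule inj_onI, rule ccontr)
    fix x y assume xy: "x \<in> B" "y \<in> B" "lin f x = lin f y" "x \<noteq> y"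
    have "\<forall>b\<in>{x, y}. (if b = x then 1 else - 1) = (0::'k)"
      by (rule ind'[of "{x, y}"]) (use xy in \<open>auto simp: lin_minus\<close>)
    then show False by simp
  qed
  have indep: "fv.independent (lin f ` B)"
    unfolding fv.dependent_explicit
  proof safe
    fix T u v assume T: "finite T" "T \<subseteq> lin f ` B" "(\<Sum>v\<in>T. vscale (u v) v) = 0" "v \<in> T" "u v \<noteq> 0"
    then obtain S where S: "S \<subseteq> B" "T = lin f ` S" by (meson subset_imageE)
    have injS: "inj_on (lin f) S" using inj S(1) inj_on_subset by blast
    have "finite S" using T(1) S(2) injS by (simp add: finite_image_iff)
    moreover have "lin f (\<Sum>b\<in>S. vscale (u (lin f b)) b) = 0"
      using T(3) S(2) injS by (simp add: lin_sum lin_scale sum.reindex)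
    ultimately have "\<forall>b\<in>S. u (lin f b) = 0" using S(1) ind'[of S "\<lambda>b. u (lin f b)"] by simp
    with T S show False by auto
  qed
  have "lin f ` V \<subseteq> fv.span (lin f ` B)"
  proof safe
    fix x assume "x \<in> V"
    then have "x \<in> fv.span (B \<union> ?W)" using sp by blast
    then show "lin f x \<in> fv.span (lin f ` B)"
    proof (induction rule: fv.span_induct_alt)
      case (step c x y)
      then have "lin f x \<in> fv.span (lin f ` B)" by (auto intro: fv.span_base fv.span_zero)
      then show ?case unfolding lin_add lin_scale by (intro fv.span_add fv.span_scale step)
    qed (simp add: fv.span_zero)
  qed
  then have "card (lin f ` B) = fv.dim (lin f ` V)"
    using BV indep by (intro fv.basis_card_eq_dim) auto
  moreover have "card (sng ` N :: ('b \<Rightarrow>\<^sub>0 'k) set) = fv.dim (fv.span (sng ` N :: ('b \<Rightarrow>\<^sub>0 'k) set))"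
    by (simp add: fv.dim_eq_card_independent independent_sng)
  moreover have "inj_on (sng :: 'b \<Rightarrow> ('b \<Rightarrow>\<^sub>0 'k)) N"
    by (rule inj_onI) (metis lookup_single_eq lookup_single_not_eq zero_neq_one)
  ultimately show ?thesis using inj im by (metis card_image)
qed

section \<open>Coherently labelled trees\<close>

lemma finite_size1: "finite {t :: 'e::finite tree. size1 t = n}"
proof (induction n rule: less_induct)
  case (less n)
  let ?T = "\<lambda>m. {t :: 'e tree. size1 t = m}"
  have "?T n \<subseteq> insert Leaf ((\<lambda>(l, e, r). Node l e r) ` ((\<Union>m<n. ?T m) \<times> UNIV \<times> (\<Union>m<n. ?T m)))"
  proof
    fix t assume "t \<in> ?T n"
    then show "t \<in> insert Leaf ((\<lambda>(l, e, r). Node l e r) ` ((\<Union>m<n. ?T m) \<times> UNIV \<times> (\<Union>m<n. ?T m)))"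
      by (cases t) (auto simp: image_iff size1_size)
  qed
  then show ?case
    by (rule finite_subset) (intro finite.insertI finite_imageI finite_cartesian_product
        finite_UN_I finite_lessThan finite_UNIV less; simp)
qed

section \<open>Signs of reordered vertices\<close>

lemma neg_one_power_cong: "even (a + b) \<Longrightarrow> (- 1) ^ a = ((- 1) ^ b :: 'k::ring_1)"
  by (cases "even a") auto

text \<open>The sign of the permutation from prefix order (root, left, right) to right-to-left infix
  order (right, root, left): the right subtree moves past the root and the left subtree, then each
  subtree is reordered.\<close>

fun tsign :: "'e tree \<Rightarrow> 'k::field" where
  "tsign \<langle>\<rangle> = 1"
| "tsign \<langle>l, e, r\<rangle> = (- 1) ^ (size r * (size l + 1)) * tsign l * tsign r"

lemma tsign_mult_self [simp]: "tsign t * tsign t = (1 :: 'k::field)"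
proof (induction t)
  case (Node l e r)
  have "tsign \<langle>l, e, r\<rangle> * tsign \<langle>l, e, r\<rangle> =
      ((- 1 :: 'k) ^ (size r * (size l + 1)) * (- 1) ^ (size r * (size l + 1))) * (tsign l * tsign l) * (tsign r * tsign r)"
    by (simp only: tsign.simps ac_simps)
  also have "\<dots> = 1" by (simp only: Node power_mult_distrib[symmetric]) simp
  finally show ?case .
qed simp

lemma tsign_mult_self_left [simp]: "tsign t * (tsign t * x) = x"
  using tsign_mult_self[of t] by (metis mult.assoc mult_1)

lemma tsign_nonzero [simp]: "tsign t \<noteq> 0"
  using tsign_mult_self[of t] by (metis mult_zero_left zero_neq_one)

lemma size_graft: "1 \<le> i \<Longrightarrow> i \<le> size1 s \<Longrightarrow> size (graft s i t) = size s + size t"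
  using size1_graft[of i s t] by (simp add: size1_size)

text \<open>In prefix order \<open>t\<close> is followed by the \<open>after s i\<close> later
  vertices of \<open>s\<close>; in right-to-left infix order it is followed by the
  \<open>i - 1\<close> vertices of \<open>s\<close> to the left of the \<open>i\<close>-th leaf.
  Moving \<open>t\<close> to the end in either order gives the two exponents.\<close>

lemma tsign_graft:
  "1 \<le> i \<Longrightarrow> i \<le> size1 s \<Longrightarrow>
    tsign (graft s i t) = (- 1) ^ (after s i * size t) * (- 1) ^ ((i - 1) * size t) * tsign s * (tsign t :: 'k::field)"
proof (induction s i t rule: graft.induct)
  case (2 l e r i t)
  show ?case
  proof (cases "i \<le> size1 l")
    case True
    have "(- 1 :: 'k) ^ (size r * (size l + size t + 1) + after l i * size t) =
      (- 1) ^ ((after l i + size r) * size t + size r * (size l + 1))"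
      by (rule neg_one_power_cong) (auto simp: algebra_simps)
    then show ?thesis
      using 2 True by (simp add: size_graft power_add[symmetric] mult.assoc[symmetric])
        (simp add: power_add algebra_simps)
  next
    case False
    let ?j = "i - size1 l"
    have j: "1 \<le> ?j" "?j \<le> size1 r" using 2 False by auto
    have "(- 1 :: 'k) ^ ((size r + size t) * (size l + 1) + (?j - 1) * size t) =
      (- 1) ^ ((i - 1) * size t + size r * (size l + 1))"
    proof (rule neg_one_power_cong)
      \<comment> \<open>Writing \<open>i\<close> as \<open>size1 l + Suc k\<close> removes the
        truncated subtractions; the exponent is then visibly even.\<close>
      obtain k where "i = size1 l + Suc k" using False by (metis less_iff_Suc_add not_le add_Suc_right)
      then show "even ((size r + size t) * (size l + 1) + (?j - 1) * size t +
          ((i - 1) * size t + size r * (size l + 1)))"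
        by (simp add: size1_size algebra_simps)
    qed
    then show ?thesis
      using 2(2)[OF False j] False j
      by (simp add: size_graft[OF j] power_add mult_ac)
  qed
qed auto

locale two_param = semigroup arr for arr :: "'w::finite \<Rightarrow> 'w \<Rightarrow> 'w" (infixl \<open>\<cdot>\<close> 70)
begin

fun wprod :: "'w list \<Rightarrow> 'w" where
  "wprod [a] = a"
| "wprod (a # b # w) = a \<cdot> wprod (b # w)"

lemma wprod_Cons: "w \<noteq> [] \<Longrightarrow> wprod (a # w) = a \<cdot> wprod w"
  by (cases w) auto

lemma wprod_append: "u \<noteq> [] \<Longrightarrow> v \<noteq> [] \<Longrightarrow> wprod (u @ v) = wprod u \<cdot> wprod v"
  by (induction u rule: wprod.induct) (auto simp: wprod_Cons assoc)

lemma wprod_collapse: "v \<noteq> [] \<Longrightarrow> wprod (u @ v @ u') = wprod (u @ wprod v # u')"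
  by (cases "u = []"; cases "u' = []") (simp_all add: wprod_append wprod_Cons)

text \<open>A leaf fits every one-letter word, so a tree determines its leaf word only if it has a
  vertex.\<close>

fun lab :: "('w \<times> 'w) tree \<Rightarrow> 'w list \<Rightarrow> bool" where
  "lab \<langle>\<rangle> w \<longleftrightarrow> length w = 1"
| "lab \<langle>l, e, r\<rangle> w \<longleftrightarrow> lab l (take (size1 l) w) \<and> lab r (drop (size1 l) w) \<and>
     e = (wprod (take (size1 l) w), wprod (drop (size1 l) w))"

lemma lab_length: "lab t w \<Longrightarrow> length w = size1 t"
proof (induction t arbitrary: w)
  case (Node l e r)
  have "size1 r > 0" "size1 l > 0" by simp_all
  then show ?case using Node.IH[of "take (size1 l) w"] Node.IH(2)[of "drop (size1 l) w"] Node.prems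
    by (auto simp: min_def split: if_splits)
qed simp

lemma lab_singleton: "lab c [a] \<longleftrightarrow> c = \<langle>\<rangle>"
  using lab_length[of c "[a]"] by (cases c) (auto simp: size1_size)

lemma lab_nonempty: "lab t w \<Longrightarrow> w \<noteq> []"
  by (auto dest: lab_length simp: size1_size)

lemma lab_Node_append:
  "length u = size1 l \<Longrightarrow> lab \<langle>l, e, r\<rangle> (u @ v) \<longleftrightarrow> lab l u \<and> lab r v \<and> e = (wprod u, wprod v)"
  by simp

lemma lab_NodeE:
  assumes "lab \<langle>l, e, r\<rangle> w"
  obtains u v where "w = u @ v" "lab l u" "lab r v" "e = (wprod u, wprod v)"
  using assms by (metis append_take_drop_id lab.simps(2))

lemma lab_NodeI: "lab l u \<Longrightarrow> lab r v \<Longrightarrow> lab \<langle>l, (wprod u, wprod v), r\<rangle> (u @ v)"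
  by (simp add: lab_length)

text \<open>Over a child that is a leaf, the component of the label is the letter itself, so no
  letter is lost once there is a vertex.\<close>

lemma lab_unique: "lab t w \<Longrightarrow> lab t w' \<Longrightarrow> t \<noteq> \<langle>\<rangle> \<Longrightarrow> w = w'"
proof (induction t arbitrary: w w')
  case (Node l e r)
  obtain u v where *: "w = u @ v" "lab l u" "lab r v" "e = (wprod u, wprod v)"
    using Node.prems(1) by (rule lab_NodeE)
  obtain u' v' where **: "w' = u' @ v'" "lab l u'" "lab r v'" "e = (wprod u', wprod v')"
    using Node.prems(2) by (rule lab_NodeE)
  have "u = u'"
  proof (cases "l = \<langle>\<rangle>")
    case True
    then show ?thesis using * ** by (auto simp: length_Suc_conv)
  qed (use Node.IH(1) * ** in blast)
  moreover have "v = v'"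
  proof (cases "r = \<langle>\<rangle>")
    case True
    then show ?thesis using * ** by (auto simp: length_Suc_conv)
  qed (use Node.IH(2) * ** in blast)
  ultimately show ?case using * ** by simp
qed simp

lemma lab_same: "lab s u \<Longrightarrow> lab s' u \<Longrightarrow> lab s w \<longleftrightarrow> lab s' w"
proof (cases "s = \<langle>\<rangle>")
  case True
  moreover assume "lab s u" "lab s' u"
  ultimately have "size1 s' = 1" using lab_length[of s' u] by simp
  then show ?thesis using True by (cases s') (auto simp: size1_size)
next
  case False
  assume *: "lab s u" "lab s' u"
  then have "size1 s = size1 s'" using lab_length by metis
  with False have "s' \<noteq> \<langle>\<rangle>" by (auto simp: size1_size)
  then show ?thesis using lab_unique False * by metis
qed

text \<open>Replacing a factor of the leaf word by its product does not change the products that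
  label the vertices of \<open>s\<close>, by associativity. Coherence therefore splits exactly along
  a grafting.\<close>

lemma lab_graft:
  "length u + Suc (length u') = size1 s \<Longrightarrow> length v = size1 t \<Longrightarrow>
    lab (graft s (Suc (length u)) t) (u @ v @ u') \<longleftrightarrow> lab s (u @ wprod v # u') \<and> lab t v"
proof (induction s arbitrary: u u')
  case (Node l e r)
  have v: "v \<noteq> []" using Node.prems(2) by (auto simp: size1_size)
  show ?case
  proof (cases "length u < size1 l")
    case True
    define u1 u2 where "u1 = take (size1 l - Suc (length u)) u'" and "u2 = drop (size1 l - Suc (length u)) u'"
    have u': "u' = u1 @ u2" "length u + Suc (length u1) = size1 l"
      using True Node.prems(1) by (auto simp: u1_def u2_def min_def)
    have "size1 (graft l (Suc (length u)) t) = length (u @ v @ u1)"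
      using size1_graft[of "Suc (length u)" l t] True u'(2) Node.prems(2) by simp
    then have "lab \<langle>graft l (Suc (length u)) t, e, r\<rangle> ((u @ v @ u1) @ u2) \<longleftrightarrow>
        (lab l (u @ wprod v # u1) \<and> lab t v) \<and> lab r u2 \<and> e = (wprod (u @ wprod v # u1), wprod u2)"
      using Node.IH(1)[OF u'(2) Node.prems(2)] wprod_collapse[OF v, of u u1]
      by (subst lab_Node_append) simp_all
    moreover have "lab \<langle>l, e, r\<rangle> ((u @ wprod v # u1) @ u2) \<longleftrightarrow>
        lab l (u @ wprod v # u1) \<and> lab r u2 \<and> e = (wprod (u @ wprod v # u1), wprod u2)"
      using u'(2) by (subst lab_Node_append) simp_all
    ultimately show ?thesis using True u' by auto
  next
    case False
    define u1 u2 where "u1 = take (size1 l) u" and "u2 = drop (size1 l) u"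
    have u: "u = u1 @ u2" "length u1 = size1 l" "length u2 + Suc (length u') = size1 r"
      using False Node.prems(1) by (auto simp: u1_def u2_def min_def)
    have "lab \<langle>l, e, graft r (Suc (length u2)) t\<rangle> (u1 @ (u2 @ v @ u')) \<longleftrightarrow>
        lab l u1 \<and> (lab r (u2 @ wprod v # u') \<and> lab t v) \<and> e = (wprod u1, wprod (u2 @ wprod v # u'))"
      using Node.IH(2)[OF u(3) Node.prems(2)] wprod_collapse[OF v, of u2 u'] u(2)
      by (subst lab_Node_append) simp_all
    moreover have "lab \<langle>l, e, r\<rangle> (u1 @ (u2 @ wprod v # u')) \<longleftrightarrow>
        lab l u1 \<and> lab r (u2 @ wprod v # u') \<and> e = (wprod u1, wprod (u2 @ wprod v # u'))"
      using u(2) by (subst lab_Node_append) simp_all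
    moreover have "Suc (length u) - size1 l = Suc (length u2)" using u by simp
    ultimately show ?thesis using False u by auto
  qed
qed auto

section \<open>The cooperad of signed sums over leaf words\<close>

lemma finite_lab: "finite {t. lab t w}"
  by (rule finite_subset[OF _ finite_size1[of "length w"]]) (auto simp: lab_length)

definition coword :: "'w list \<Rightarrow> (('w \<times> 'w) tree \<Rightarrow>\<^sub>0 'k::field)" where
  "coword w = (\<Sum>t | lab t w. Poly_Mapping.single t (tsign t))"

lemma lookup_coword: "lookup (coword w) t = (if lab t w then tsign t else 0)"
proof -
  have "lookup (coword w) t = (\<Sum>s | lab s w. if s = t then tsign t else 0)"
    unfolding coword_def lookup_sum by (rule sum.cong) (auto simp: lookup_single when_def)
  then show ?thesis using finite_lab by simp
qed

lemma tsign_lookup_coword: "tsign t * lookup (coword w) t = (if lab t w then 1 else 0)"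
  by (simp add: lookup_coword)

fun comb :: "'w list \<Rightarrow> ('w \<times> 'w) tree" where
  "comb (a # b # w) = \<langle>\<langle>\<rangle>, (a, wprod (b # w)), comb (b # w)\<rangle>"
| "comb w = \<langle>\<rangle>"

lemma lab_comb: "w \<noteq> [] \<Longrightarrow> lab (comb w) w"
  by (induction w rule: comb.induct) auto

lemma comb_Cons: "w \<noteq> [] \<Longrightarrow> comb (a # w) = \<langle>\<langle>\<rangle>, (a, wprod w), comb w\<rangle>"
  by (cases w) auto

definition codual :: "nat \<Rightarrow> (('w \<times> 'w) tree \<Rightarrow>\<^sub>0 'k::field) set" where
  "codual n = fv.span (coword ` {w. length w = n})"

lemma coword_in_codual: "length w = n \<Longrightarrow> coword w \<in> codual n"
  unfolding codual_def by (auto intro: fv.span_base)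

lemma subspace_codual: "fv.subspace (codual n)"
  unfolding codual_def by simp

lemma codual_subset_free_op: "codual n \<subseteq> free_op n"
  unfolding codual_def
  by (rule fv.span_minimal[OF _ subspace_free_op])
    (auto simp: free_op_def in_keys_iff lookup_coword lab_length split: if_splits)

end

lemma lookup_tensor2 [simp]: "lookup (tensor2 x y) (s, t) = lookup x s * lookup y t"
proof -
  have "lookup (tensor2 x y) (s, t) =
     (\<Sum>s'\<in>keys x. \<Sum>t'\<in>keys y. if s' = s then if t' = t then lookup x s * lookup y t else 0 else 0)"
    unfolding tensor2_def lookup_sum
    by (intro sum.cong refl) (auto simp: lookup_single when_def)
  also have "\<dots> = (\<Sum>s'\<in>keys x. if s' = s then lookup x s * lookup y t else 0)"
    by (intro sum.cong refl) (auto simp: in_keys_iff)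
  also have "\<dots> = lookup x s * lookup y t" by (auto simp: in_keys_iff)
  finally show ?thesis .
qed

context two_param begin

text \<open>The leaf word is cut at the leaves of the grafted tree. The decomposition of
  \<open>coword w\<close> is then a tensor of two cowords up to one sign, because the factor with
  \<open>after\<close> cancels against the one in \<open>tsign_graft\<close>.\<close>

lemma codual_decompose:
  assumes i: "1 \<le> i" "i \<le> m" and n: "1 \<le> n" and x: "x \<in> codual (m + n - 1)"
  shows "\<exists>z \<in> fv.span {tensor2 a b | a b. a \<in> codual m \<and> b \<in> codual n}.
    \<forall>s t. size1 s = m \<and> size1 t = n \<longrightarrow>
      lookup z (s, t) = (- 1) ^ (after s i * size t) * lookup x (graft s i t)"
  using x unfolding codual_def[of "m + n - 1"]
proof (induction rule: fv.span_induct_alt)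
  case base
  show ?case by (auto intro: bexI[of _ 0] fv.span_zero)
next
  case (step c x y)
  then obtain w where w: "x = coword w" "length w = m + n - 1" by auto
  define u v u' where "u = take (i - 1) w" and "v = take n (drop (i - 1) w)" and "u' = drop (i - 1 + n) w"
  have uvu: "w = u @ v @ u'"
    unfolding u_def v_def u'_def by (metis append_take_drop_id drop_drop add.commute)
  have len: "length u = i - 1" "length v = n" "length u + Suc (length u') = m"
    using i n w(2) by (auto simp: u_def v_def u'_def)
  obtain z where z: "z \<in> fv.span {tensor2 a b | a b. a \<in> codual m \<and> b \<in> codual n}"
    "\<And>s t. size1 s = m \<Longrightarrow> size1 t = n \<Longrightarrow>
      lookup z (s, t) = (- 1) ^ (after s i * size t) * lookup y (graft s i t)"
    using step.IH by blast
  \<comment> \<open>A tree with \<open>n\<close> leaves has \<open>n - 1\<close> vertices, so the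
    remaining sign depends on \<open>i\<close> and \<open>n\<close> only and can be taken out as a
    common coefficient.\<close>
  let ?z = "vscale (c * (- 1) ^ ((i - 1) * (n - 1))) (tensor2 (coword (u @ wprod v # u')) (coword v)) + z"
  have "?z \<in> fv.span {tensor2 a b | a b. a \<in> codual m \<and> b \<in> codual n}"
  proof (intro fv.span_add fv.span_scale z(1) fv.span_base)
    have "coword (u @ wprod v # u') \<in> codual m" "coword v \<in> codual n"
      using len by (auto intro!: coword_in_codual)
    then show "tensor2 (coword (u @ wprod v # u')) (coword v) \<in>
        {tensor2 a b | a b. a \<in> codual m \<and> b \<in> codual n}" by blast
  qed
  moreover have "lookup ?z (s, t) = (- 1) ^ (after s i * size t) * lookup (vscale c x + y) (graft s i t)"
    if st: "size1 s = m" "size1 t = n" for s t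
  proof -
    have "lab (graft s i t) w \<longleftrightarrow> lab s (u @ wprod v # u') \<and> lab t v"
      using lab_graft[of u u' s v t] len st i uvu by simp
    note lab = this
    define A B where "A = ((- 1) ^ (after s i * size t) :: 'a)" and "B = ((- 1) ^ ((i - 1) * size t) :: 'a)"
    have A: "A * (A * a) = a" for a
      by (simp add: A_def mult.assoc[symmetric] power_mult_distrib[symmetric])
    have n1: "n - 1 = size t" using st by (simp add: size1_size)
    have "tsign (graft s i t) = A * B * tsign s * tsign t"
      using tsign_graft[of i s t] st i by (simp add: A_def B_def)
    then have "lookup ?z (s, t) = A * lookup (vscale c x + y) (graft s i t)"
      using z(2)[OF st] unfolding A_def[symmetric] B_def[symmetric] n1
      by (simp add: lookup_add lookup_coword w(1) lab distrib_left A mult_ac)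
    then show ?thesis by (simp only: A_def)
  qed
  ultimately show ?case by blast
qed

lemma sub_cooperad_codual: "sub_cooperad codual"
  unfolding sub_cooperad_def
  using codual_decompose subspace_codual codual_subset_free_op by blast

end

lemma pcomp_single:
  "pcomp (Poly_Mapping.single s a) i (Poly_Mapping.single t b) = Poly_Mapping.single (graft s i t) (a * b)"
  by (simp add: pcomp_def)

context two_param begin

section \<open>The Koszul dual cooperad\<close>

lemma lab_length3:
  "lab t [\<alpha>, \<beta>, \<gamma>] \<longleftrightarrow> t = \<langle>\<langle>\<langle>\<rangle>, (\<alpha>, \<beta>), \<langle>\<rangle>\<rangle>, (\<alpha> \<cdot> \<beta>, \<gamma>), \<langle>\<rangle>\<rangle> \<or>
     t = \<langle>\<langle>\<rangle>, (\<alpha>, \<beta> \<cdot> \<gamma>), \<langle>\<langle>\<rangle>, (\<beta>, \<gamma>), \<langle>\<rangle>\<rangle>\<rangle>"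
proof
  assume *: "lab t [\<alpha>, \<beta>, \<gamma>]"
  then obtain l e r where t: "t = \<langle>l, e, r\<rangle>" by (cases t) auto
  have "size l + size r = 1" using lab_length[OF *] by (simp add: t size1_size)
  then have "size l = 0 \<and> size r = 1 \<or> size l = 1 \<and> size r = 0" by arith
  then show "t = \<langle>\<langle>\<langle>\<rangle>, (\<alpha>, \<beta>), \<langle>\<rangle>\<rangle>, (\<alpha> \<cdot> \<beta>, \<gamma>), \<langle>\<rangle>\<rangle> \<or>
     t = \<langle>\<langle>\<rangle>, (\<alpha>, \<beta> \<cdot> \<gamma>), \<langle>\<langle>\<rangle>, (\<beta>, \<gamma>), \<langle>\<rangle>\<rangle>\<rangle>"
    using * unfolding t by (cases l; cases r) auto
qed auto

text \<open>A three-letter word has exactly two coherent trees, the two sides of the relation, and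
  \<open>tsign\<close> is -1 on the right comb.\<close>

lemma As2_rel_eq_coword:
  "pcomp (gen (\<alpha> \<cdot> \<beta>, \<gamma>)) 1 (gen (\<alpha>, \<beta>)) - pcomp (gen (\<alpha>, \<beta> \<cdot> \<gamma>)) 2 (gen (\<beta>, \<gamma>)) = coword [\<alpha>, \<beta>, \<gamma>]"
  by (rule poly_mapping_eqI)
    (auto simp: gen_def pcomp_single corolla_def lookup_minus lookup_coword lab_length3 lookup_single when_def)

lemma As2_rels_eq: "As2_rels arr = coword ` {w. length w = 3}"
  unfolding As2_rels_def As2_rel_eq_coword by (auto simp: numeral_3_eq_3 length_Suc_conv image_iff)

lemma span_As2_rels: "fv.span (As2_rels arr) = codual 3"
  by (simp add: As2_rels_eq codual_def)

lemma finite_words: "finite {w :: 'w list. length w = n}"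
  using finite_lists_length_eq[of "UNIV :: 'w set" n] by simp

section \<open>Coherence tested edge by edge\<close>

definition coh :: "('w \<times> 'w) tree \<Rightarrow> bool" where
  "coh t \<longleftrightarrow> (\<exists>w. lab t w)"

text \<open>Coherence becomes a condition on single edges, which partial decompositions can detect;
  a leaf imposes none because its letter is free.\<close>

fun root_prod_eq :: "('w \<times> 'w) tree \<Rightarrow> 'w \<Rightarrow> bool" where
  "root_prod_eq \<langle>\<rangle> a = True"
| "root_prod_eq \<langle>l, (c, d), r\<rangle> a = (a = c \<cdot> d)"

lemma coh_Leaf [simp]: "coh \<langle>\<rangle>"
  unfolding coh_def by (auto intro: exI[of _ "[undefined]"])

lemma root_prod_eq_lab: "lab t w \<Longrightarrow> root_prod_eq t (wprod w)"
proof (cases t)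
  case (Node l e r)
  moreover assume "lab t w"
  ultimately show ?thesis by (auto elim!: lab_NodeE simp: wprod_append lab_nonempty simp del: lab.simps)
qed simp

lemma coh_lab_root_prod:
  assumes "coh t" "root_prod_eq t a"
  shows "\<exists>w. lab t w \<and> wprod w = a"
proof (cases t)
  case Leaf
  then show ?thesis by (auto intro: exI[of _ "[a]"])
next
  case (Node l e r)
  obtain w where "lab t w" using assms(1) coh_def by blast
  then have "root_prod_eq t (wprod w)" by (rule root_prod_eq_lab)
  then have "wprod w = a" using assms(2) Node by (cases e) simp
  with \<open>lab t w\<close> show ?thesis by blast
qed

lemma coh_Node [simp]:
  "coh \<langle>l, (a, b), r\<rangle> \<longleftrightarrow> coh l \<and> coh r \<and> root_prod_eq l a \<and> root_prod_eq r b"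
proof
  assume "coh \<langle>l, (a, b), r\<rangle>"
  then obtain w where "lab \<langle>l, (a, b), r\<rangle> w" unfolding coh_def by blast
  then show "coh l \<and> coh r \<and> root_prod_eq l a \<and> root_prod_eq r b"
    by (rule lab_NodeE) (auto simp: coh_def root_prod_eq_lab)
next
  assume "coh l \<and> coh r \<and> root_prod_eq l a \<and> root_prod_eq r b"
  then obtain u v where "lab l u" "wprod u = a" "lab r v" "wprod v = b"
    using coh_lab_root_prod by metis
  then show "coh \<langle>l, (a, b), r\<rangle>" using lab_NodeI coh_def by blast
qed

text \<open>Multiplied by \<open>tsign\<close>, the coordinates of a coword are the indicator of
  \<open>lab\<close>, so they see only which words fit the tree.\<close>

lemma codual_lookup_same:
  assumes "a \<in> codual m" "\<And>w. lab s w \<longleftrightarrow> lab s' w"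
  shows "tsign s * lookup a s = tsign s' * lookup a s'"
  using assms(1) unfolding codual_def
proof (induction rule: fv.span_induct_alt)
  case (step c x y)
  then obtain w where "x = coword w" by blast
  then have "tsign s * lookup x s = tsign s' * lookup x s'" using assms(2) by (simp add: tsign_lookup_coword)
  with step.IH show ?case
    by (simp add: lookup_add distrib_left mult.left_commute[of "tsign s" c] mult.left_commute[of "tsign s'" c])
qed simp

lemma codual_lookup_incoherent:
  assumes "a \<in> codual m" "\<not> coh s"
  shows "lookup a s = 0"
  using assms(1) unfolding codual_def
proof (induction rule: fv.span_induct_alt)
  case (step c x y)
  then show ?case using assms(2) by (auto simp: lookup_add lookup_coword coh_def)
qed simp

text \<open>In arity at least 2 every tree has a vertex and hence at most one leaf word, so distinct
  cowords have disjoint supports and \<open>g w\<close> is the coefficient of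
  \<open>coword w\<close>.\<close>

lemma codual_criterion:
  assumes "x \<in> free_op n" "n \<ge> 2"
    and g: "\<And>t w. lab t w \<Longrightarrow> length w = n \<Longrightarrow> tsign t * lookup x t = g w"
    and 0: "\<And>t. size1 t = n \<Longrightarrow> \<not> coh t \<Longrightarrow> lookup x t = 0"
  shows "x \<in> codual n"
proof -
  have "x = (\<Sum>w | length w = n. vscale (g w) (coword w))"
  proof (rule poly_mapping_eqI)
    fix t
    have R: "lookup (\<Sum>w | length w = n. vscale (g w) (coword w)) t =
      (\<Sum>w | length w = n. if lab t w then g w * tsign t else 0)"
      unfolding lookup_sum by (rule sum.cong) (auto simp: lookup_coword)
    show "lookup x t = lookup (\<Sum>w | length w = n. vscale (g w) (coword w)) t"
    proof (cases "size1 t = n \<and> coh t")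
      case True
      then obtain w where w: "lab t w" "length w = n" using lab_length coh_def by metis
      have "t \<noteq> \<langle>\<rangle>" using True assms(2) by auto
      then have "lab t w' \<longleftrightarrow> w' = w" for w' using w lab_unique by blast
      then have "lookup (\<Sum>w | length w = n. vscale (g w) (coword w)) t = g w * tsign t"
        unfolding R using w(2) by (simp add: finite_words)
      also have "\<dots> = lookup x t" using g[OF w] by (metis mult.commute tsign_mult_self_left)
      finally show ?thesis by simp
    next
      case False
      then have "lookup x t = 0"
        using assms(1) 0[of t] by (cases "size1 t = n") (auto simp: free_op_def in_keys_iff)
      moreover have "\<not> lab t w" if "length w = n" for w
        using that False lab_length coh_def by metis
      ultimately show ?thesis unfolding R by simp
    qed
  qed
  moreover have "(\<Sum>w | length w = n. vscale (g w) (coword w)) \<in> codual n"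
    by (intro fv.subspace_sum fv.subspace_scale subspace_codual) (simp add: coword_in_codual)
  ultimately show ?thesis by (simp only:)
qed

text \<open>A rotation at an edge, and coherence of an edge, can be tested inside one of the two factors
  of a proper partial decomposition as soon as there are at least three internal vertices.\<close>

context
  fixes f :: "('w \<times> 'w) tree \<Rightarrow> 'k::field" and n :: nat
  assumes n: "n \<ge> 4"
    and same: "\<And>s s' t t' i u v. lab s u \<Longrightarrow> lab s' u \<Longrightarrow> lab t v \<Longrightarrow> lab t' v \<Longrightarrow> s \<noteq> \<langle>\<rangle> \<Longrightarrow> t \<noteq> \<langle>\<rangle> \<Longrightarrow>
      1 \<le> i \<Longrightarrow> i \<le> size1 s \<Longrightarrow> size1 (graft s i t) = n \<Longrightarrow> f (graft s i t) = f (graft s' i t')"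
    and incoherent: "\<And>s t i. \<not> coh s \<or> \<not> coh t \<Longrightarrow> s \<noteq> \<langle>\<rangle> \<Longrightarrow> t \<noteq> \<langle>\<rangle> \<Longrightarrow>
      1 \<le> i \<Longrightarrow> i \<le> size1 s \<Longrightarrow> size1 (graft s i t) = n \<Longrightarrow> f (graft s i t) = 0"
begin

text \<open>The edge between the root and \<open>r\<close> is cut and \<open>r\<close> is replaced
  by its right comb; as the left subtree is trivial, the whole tree becomes a right comb.\<close>

lemma eq_comb_left_Leaf:
  assumes "lab \<langle>\<langle>\<rangle>, e, r\<rangle> w" "length w = n"
  shows "f \<langle>\<langle>\<rangle>, e, r\<rangle> = f (comb w)"
proof -
  obtain u v where *: "w = u @ v" "lab \<langle>\<rangle> u" "lab r v" "e = (wprod u, wprod v)"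
    using assms(1) by (rule lab_NodeE)
  then obtain a where a: "u = [a]" by (auto simp: length_Suc_conv)
  have v: "length v = n - 1" "v \<noteq> []" using * a assms(2) n by auto
  have r: "r \<noteq> \<langle>\<rangle>" using * v n by auto
  have "f (graft (corolla e) 2 r) = f (graft (corolla e) 2 (comb v))"
    by (rule same[of _ "[a, wprod v]" _ _ v])
      (use * a v r lab_comb lab_length[OF *(3)] n in \<open>auto simp: corolla_def\<close>)
  then show ?thesis using * a v by (simp add: corolla_def comb_Cons)
qed

lemma lab_graftE:
  assumes "lab (graft s i t) w" "1 \<le> i" "i \<le> size1 s"
  obtains u v u' where "w = u @ v @ u'" "i = Suc (length u)" "length u + Suc (length u') = size1 s"
    "length v = size1 t" "lab s (u @ wprod v # u')" "lab t v"
proof -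
  define u v u' where "u = take (i - 1) w" and "v = take (size1 t) (drop (i - 1) w)"
    and "u' = drop (i - 1 + size1 t) w"
  have w: "w = u @ v @ u'"
    unfolding u_def v_def u'_def by (metis append_take_drop_id drop_drop add.commute)
  have "length w = size1 s + size1 t - 1"
    using lab_length[OF assms(1)] size1_graft[OF assms(2,3)] by simp
  then have "length u + Suc (length u') = size1 s" "length v = size1 t" "i = Suc (length u)"
    using assms(2,3) by (auto simp: u_def v_def u'_def size1_size)
  then show ?thesis using that w assms(1) lab_graft[of u u' s v t] by blast
qed

text \<open>Since \<open>i\<close> is at least 2, replacing the upper factor by its right comb
  leaves the first leaf ungrafted. The new tree has a trivial left subtree, so the previous case
  applies.\<close>

lemma eq_comb_graft:
  assumes "lab (graft s i t) w" "length w = n" "s \<noteq> \<langle>\<rangle>" "t \<noteq> \<langle>\<rangle>" "2 \<le> i" "i \<le> size1 s"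
  shows "f (graft s i t) = f (comb w)"
proof -
  obtain u v u' where *: "w = u @ v @ u'" "i = Suc (length u)" "length u + Suc (length u') = size1 s"
    "length v = size1 t" "lab s (u @ wprod v # u')" "lab t v"
    by (rule lab_graftE[OF assms(1) _ assms(6)]) (use assms(5) in simp)
  let ?U = "u @ wprod v # u'"
  obtain a u0 where "u = a # u0" using *(2) assms(5) by (cases u) auto
  then obtain e c where c: "comb ?U = \<langle>\<langle>\<rangle>, e, c\<rangle>" by (simp add: comb_Cons)
  have lU: "lab (comb ?U) ?U" by (rule lab_comb) simp
  have sz: "size1 (comb ?U) = size1 s" using lab_length[OF lU] *(3) by simp
  have "f (graft s i t) = f (graft (comb ?U) i t)"
  proof (rule same[of _ ?U _ _ v])
    show "size1 (graft s i t) = n" using lab_length[OF assms(1)] assms(2) by simp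
  qed (use * assms(3-6) lU in simp_all)
  moreover have "lab (graft (comb ?U) i t) w"
    using lab_graft[of u u' "comb ?U" v t] * lU sz by simp
  moreover have "graft (comb ?U) i t = \<langle>\<langle>\<rangle>, e, graft c (i - 1) t\<rangle>" using assms(5) c by simp
  ultimately show ?thesis using eq_comb_left_Leaf[OF _ assms(2)] by simp
qed

lemma eq_comb:
  assumes "lab t w" "length w = n"
  shows "f t = f (comb w)"
proof -
  have sz: "size1 t = n" using assms lab_length by metis
  obtain l e r where t: "t = \<langle>l, e, r\<rangle>" using sz n by (cases t) auto
  consider "l = \<langle>\<rangle>" | "l \<noteq> \<langle>\<rangle>" "r \<noteq> \<langle>\<rangle>" | "l \<noteq> \<langle>\<rangle>" "r = \<langle>\<rangle>" by blast
  then show ?thesis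
  proof cases
    case 1
    then show ?thesis using eq_comb_left_Leaf assms t by simp
  next
    case 2
    then show ?thesis using eq_comb_graft[of "\<langle>l, e, \<langle>\<rangle>\<rangle>" "Suc (size1 l)" r w] assms t
      by (simp add: size1_size)
  next
    case 3
    then obtain l1 c l2 where l: "l = \<langle>l1, c, l2\<rangle>" by (cases l) auto
    show ?thesis
    proof (cases "l2 = \<langle>\<rangle>")
      case False
      then show ?thesis
        using eq_comb_graft[of "\<langle>\<langle>l1, c, \<langle>\<rangle>\<rangle>, e, \<langle>\<rangle>\<rangle>" "Suc (size1 l1)" l2 w] assms t l 3
        by (simp add: size1_size)
    next
      case True
      \<comment> \<open>The top two vertices form a left comb with \<open>l1\<close> on its first
        leaf. Rotating them, with \<open>l1\<close> cut off, gives the root a nontrivial right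
        subtree, which can be cut off in turn.\<close>
      let ?s = "\<langle>\<langle>\<langle>\<rangle>, c, \<langle>\<rangle>\<rangle>, e, \<langle>\<rangle>\<rangle>"
      have ts: "t = graft ?s 1 l1" using t l 3 True by simp
      have l1: "l1 \<noteq> \<langle>\<rangle>" using sz n t l 3 True by auto
      obtain u v u' where *: "w = u @ v @ u'" "1 = Suc (length u)" "length u + Suc (length u') = size1 ?s"
        "length v = size1 l1" "lab ?s (u @ wprod v # u')" "lab l1 v"
        by (rule lab_graftE[of ?s 1 l1 w]) (use assms(1) ts in auto)
      then obtain b d where bd: "u = []" "u' = [b, d]" by (auto simp: length_Suc_conv)
      let ?U = "[wprod v, b, d]"
      have lU: "lab (comb ?U) ?U" by (rule lab_comb) simp
      have eq: "graft (comb ?U) 1 l1 = \<langle>l1, (wprod v, b \<cdot> d), \<langle>\<langle>\<rangle>, (b, d), \<langle>\<rangle>\<rangle>\<rangle>" by simp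
      have "f t = f (graft (comb ?U) 1 l1)"
        unfolding ts
        by (rule same[of _ ?U _ _ v]) (use * bd l1 lU sz ts in auto)
      moreover have "lab (graft (comb ?U) 1 l1) w"
        using lab_graft[of u u' "comb ?U" v l1] * lU bd by simp
      ultimately show ?thesis
        using eq_comb_graft[OF _ assms(2), of "\<langle>l1, (wprod v, b \<cdot> d), \<langle>\<rangle>\<rangle>" "Suc (size1 l1)" "\<langle>\<langle>\<rangle>, (b, d), \<langle>\<rangle>\<rangle>"] l1
        unfolding eq by (simp add: size1_size del: lab.simps)
    qed
  qed
qed

lemma eq_0_incoherent:
  assumes "size1 t = n" "\<not> coh t"
  shows "f t = 0"
proof (rule ccontr)
  assume f: "f t \<noteq> 0"
  have split: "coh s \<and> coh t'"
    if "t = graft s i t'" "s \<noteq> \<langle>\<rangle>" "t' \<noteq> \<langle>\<rangle>" "1 \<le> i" "i \<le> size1 s" for s i t'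
    using incoherent[of s t' i] that f assms(1) by blast
  obtain l a b r where t: "t = \<langle>l, (a, b), r\<rangle>" using assms(1) n by (cases t) auto
  consider "l \<noteq> \<langle>\<rangle>" "r \<noteq> \<langle>\<rangle>" | "l \<noteq> \<langle>\<rangle>" "r = \<langle>\<rangle>" | "l = \<langle>\<rangle>" "r \<noteq> \<langle>\<rangle>" | "l = \<langle>\<rangle>" "r = \<langle>\<rangle>" by blast
  then have "coh t"
  proof cases
    case 1
    then show ?thesis
      using split[of "\<langle>l, (a, b), \<langle>\<rangle>\<rangle>" "Suc (size1 l)" r] split[of "\<langle>\<langle>\<rangle>, (a, b), r\<rangle>" 1 l] t
      by (auto simp: size1_size)
  next
    case 2
    then obtain l1 c d l2 where l: "l = \<langle>l1, (c, d), l2\<rangle>" by (cases l) auto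
    \<comment> \<open>Here a third vertex is needed: cutting off a subtree of \<open>l\<close> keeps
      the edge between the root and \<open>l\<close> inside the upper factor, whose coherence gives
      the condition on that edge.\<close>
    have "l1 \<noteq> \<langle>\<rangle> \<or> l2 \<noteq> \<langle>\<rangle>" using assms(1) n t l 2 by auto
    then show ?thesis
      using split[of "\<langle>\<langle>\<rangle>, (a, b), \<langle>\<rangle>\<rangle>" 1 l] split[of "\<langle>\<langle>\<langle>\<rangle>, (c, d), l2\<rangle>, (a, b), \<langle>\<rangle>\<rangle>" 1 l1]
        split[of "\<langle>\<langle>l1, (c, d), \<langle>\<rangle>\<rangle>, (a, b), \<langle>\<rangle>\<rangle>" "Suc (size1 l1)" l2] t l 2
      by (auto simp: size1_size)
  next
    case 3
    then obtain l1 c d l2 where r: "r = \<langle>l1, (c, d), l2\<rangle>" by (cases r) auto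
    have "l1 \<noteq> \<langle>\<rangle> \<or> l2 \<noteq> \<langle>\<rangle>" using assms(1) n t r 3 by auto
    then show ?thesis
      using split[of "\<langle>\<langle>\<rangle>, (a, b), \<langle>\<rangle>\<rangle>" 2 r] split[of "\<langle>\<langle>\<rangle>, (a, b), \<langle>\<langle>\<rangle>, (c, d), l2\<rangle>\<rangle>" 2 l1]
        split[of "\<langle>\<langle>\<rangle>, (a, b), \<langle>l1, (c, d), \<langle>\<rangle>\<rangle>\<rangle>" "Suc (Suc (size1 l1))" l2] t r 3
      by (auto simp: size1_size)
  next
    case 4
    then show ?thesis using assms(1) n t by auto
  qed
  with assms(2) show False ..
qed

end

text \<open>The decomposition of \<open>x\<close> lies in a tensor product of two spaces of cowords,
  where coordinates vanish on incoherent trees and, up to \<open>tsign\<close>, depend on leaf words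
  only. By \<open>tsign_graft\<close> this carries over to \<open>x\<close> itself.\<close>

lemma decomposition_lookup:
  fixes C :: "nat \<Rightarrow> (('w \<times> 'w) tree \<Rightarrow>\<^sub>0 'k::field) set"
  assumes C: "sub_cooperad C" "C m \<subseteq> codual m" "C n \<subseteq> codual n" and x: "x \<in> C (m + n - 1)"
    and i: "1 \<le> i" "i \<le> m" and st: "size1 s = m" "size1 t = n"
  shows "\<not> coh s \<or> \<not> coh t \<Longrightarrow> lookup x (graft s i t) = 0"
    and "lab s u \<Longrightarrow> lab s' u \<Longrightarrow> lab t v \<Longrightarrow> lab t' v \<Longrightarrow>
      tsign (graft s i t) * lookup x (graft s i t) = tsign (graft s' i t') * lookup x (graft s' i t')"
proof -
  have "1 \<le> n" using st size1_ge0[of t] by linarith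
  then obtain z where z: "z \<in> fv.span {tensor2 a b | a b. a \<in> C m \<and> b \<in> C n}"
    and lz: "\<And>s t. size1 s = m \<Longrightarrow> size1 t = n \<Longrightarrow>
      lookup z (s, t) = (- 1) ^ (after s i * size t) * lookup x (graft s i t)"
    using C(1) x i unfolding sub_cooperad_def by blast
  have lx: "tsign (graft s i t) * lookup x (graft s i t) =
      (- 1) ^ ((i - 1) * (n - 1)) * (tsign s * tsign t * lookup z (s, t))"
    if "size1 s = m" "size1 t = n" for s t
  proof -
    have "n - 1 = size t" using that by (simp add: size1_size)
    then show ?thesis
      using tsign_graft[of i s t, where 'k = 'k] lz[OF that] i that by (simp add: ac_simps)
  qed
  have "\<not> coh s \<or> \<not> coh t \<Longrightarrow> lookup z (s, t) = 0"
    using z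
  proof (induction rule: fv.span_induct_alt)
    case (step c x y)
    then show ?case using C(2,3) codual_lookup_incoherent by (fastforce simp: lookup_add)
  qed simp
  then show "\<not> coh s \<or> \<not> coh t \<Longrightarrow> lookup x (graft s i t) = 0"
    using lz[OF st] by simp
  assume lab: "lab s u" "lab s' u" "lab t v" "lab t' v"
  have "tsign s * tsign t * lookup z (s, t) = tsign s' * tsign t' * lookup z (s', t')"
    using z
  proof (induction rule: fv.span_induct_alt)
    case (step c x y)
    then obtain a b where ab: "x = tensor2 a b" "a \<in> codual m" "b \<in> codual n" using C(2,3) by blast
    have "tsign s * lookup a s = tsign s' * lookup a s'"
      by (rule codual_lookup_same[OF ab(2) lab_same[OF lab(1,2)]])
    moreover have "tsign t * lookup b t = tsign t' * lookup b t'"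
      by (rule codual_lookup_same[OF ab(3) lab_same[OF lab(3,4)]])
    ultimately have "(tsign s * lookup a s) * (tsign t * lookup b t) = (tsign s' * lookup a s') * (tsign t' * lookup b t')"
      by simp
    then show ?case using step.IH ab(1) by (simp add: lookup_add distrib_left mult_ac)
  qed simp
  moreover have st': "size1 s' = m" "size1 t' = n" using lab st lab_length by metis+
  ultimately show "tsign (graft s i t) * lookup x (graft s i t) = tsign (graft s' i t') * lookup x (graft s' i t')"
    by (simp only: lx[OF st] lx[OF st'])
qed

text \<open>Induction on the arity. Arities 1 and 2 impose nothing, since the trivial tree and all
  corollas are coherent; arity 3 is the assumption; from arity 4 on, proper decompositions into
  smaller arities force the criterion.\<close>

lemma sub_cooperad_subset_codual:
  fixes C :: "nat \<Rightarrow> (('w \<times> 'w) tree \<Rightarrow>\<^sub>0 'k::field) set"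
  assumes C: "sub_cooperad C" "C 3 \<subseteq> codual 3"
  shows "C n \<subseteq> codual n"
proof (induction n rule: less_induct)
  case (less n)
  have free: "C n \<subseteq> free_op n" using C(1) unfolding sub_cooperad_def by blast
  consider "n = 0" | "n = 1" | "n = 2" | "n = 3" | "n \<ge> 4" by linarith
  then show ?case
  proof cases
    case 1
    then show ?thesis using free subspace_codual[THEN fv.subspace_0] by (auto simp: free_op_def size1_size)
  next
    case 2
    show ?thesis
    proof
      fix x assume "x \<in> C n"
      then have x: "t = \<langle>\<rangle>" if "t \<in> keys x" for t
        using that free 2 unfolding free_op_def by (cases t) (auto simp: size1_size)
      \<comment> \<open>All one-letter words give the trivial tree, so the letter is
        arbitrary.\<close>
      have "sng \<langle>\<rangle> = (coword [undefined] :: _ \<Rightarrow>\<^sub>0 'k)"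
        by (intro poly_mapping_eqI) (auto simp: lookup_coword lookup_single when_def lab_singleton)
      moreover have "(coword [undefined] :: _ \<Rightarrow>\<^sub>0 'k) \<in> codual n" using 2 by (intro coword_in_codual) simp
      ultimately have "(sng t :: _ \<Rightarrow>\<^sub>0 'k) \<in> codual n" if "t \<in> keys x" for t using x[OF that] by simp
      then have "lin sng x \<in> codual n" by (rule lin_in_subspace[OF subspace_codual])
      then show "x \<in> codual n" by simp
    qed
  next
    case 3
    show ?thesis
    proof
      fix x assume "x \<in> C n"
      then have x: "x \<in> free_op n" using free by blast
      have cor: "\<exists>e. t = corolla e" if "size1 t = 2" for t :: "('w \<times> 'w) tree"
        using that by (cases t) (auto simp: size1_size corolla_def)
      have 2: "t = comb w" if "lab t w" "length w = n" for t w
      proof -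
        have "size1 t = 2" using that 3 lab_length by metis
        then obtain e where e: "t = corolla e" using cor by blast
        have "length w = Suc (Suc 0)" using that(2) 3 by simp
        then obtain a b where "w = [a, b]" by (auto simp: length_Suc_conv)
        then show ?thesis using that(1) e by (simp add: corolla_def)
      qed
      show "x \<in> codual n"
      proof (rule codual_criterion[OF x])
        show "lookup x t = 0" if "size1 t = n" "\<not> coh t" for t
          using that 3 cor[of t] by (auto simp: corolla_def)
        show "tsign t * lookup x t = tsign (comb w) * lookup x (comb w)" if "lab t w" "length w = n" for t w
          using 2[OF that] by simp
      qed (use 3 in simp)
    qed
  next
    case 4
    then show ?thesis using C(2) by simp
  next
    case 5
    show ?thesis
    proof
      fix x assume x: "x \<in> C n"
      define f where "f t = tsign t * lookup x t" for t
      have dec: "C (size1 s) \<subseteq> codual (size1 s)" "C (size1 t) \<subseteq> codual (size1 t)"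
        "x \<in> C (size1 s + size1 t - 1)"
        if "s \<noteq> \<langle>\<rangle>" "t \<noteq> \<langle>\<rangle>" "1 \<le> i" "i \<le> size1 s" "size1 (graft s i t) = n"
        for s t :: "('w \<times> 'w) tree" and i
      proof -
        \<comment> \<open>As both factors have a vertex, both have fewer leaves than the grafted
          tree, so the induction hypothesis applies to them.\<close>
        have "size s > 0" "size t > 0" using that by (auto simp: neq_Leaf_iff)
        moreover have "size1 s + size1 t - 1 = n" using that size1_graft by metis
        ultimately show "C (size1 s) \<subseteq> codual (size1 s)" "C (size1 t) \<subseteq> codual (size1 t)"
          "x \<in> C (size1 s + size1 t - 1)"
          using x by (auto simp: size1_size intro!: less[THEN subsetD])
      qed
      have same: "f (graft s i t) = f (graft s' i t')"
        if "lab s u" "lab s' u" "lab t v" "lab t' v" "s \<noteq> \<langle>\<rangle>" "t \<noteq> \<langle>\<rangle>"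
          "1 \<le> i" "i \<le> size1 s" "size1 (graft s i t) = n" for s s' t t' i u v
        unfolding f_def
        by (rule decomposition_lookup(2)[OF C(1) dec[OF that(5-9)] that(7,8) refl refl that(1-4)])
      have inc: "f (graft s i t) = 0"
        if "\<not> coh s \<or> \<not> coh t" "s \<noteq> \<langle>\<rangle>" "t \<noteq> \<langle>\<rangle>" "1 \<le> i" "i \<le> size1 s" "size1 (graft s i t) = n" for s t i
        unfolding f_def
        using decomposition_lookup(1)[OF C(1) dec[OF that(2-6)] that(4,5) refl refl that(1)] by simp
      show "x \<in> codual n"
      proof (rule codual_criterion)
        show "x \<in> free_op n" using x free by blast
        show "tsign t * lookup x t = f (comb w)" if "lab t w" "length w = n" for t w
        proof -
          have "f t = f (comb w)"
            by (rule eq_comb[where f = f, OF 5 _ _ that]) (rule same inc; assumption)+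
          then show ?thesis by (simp only: f_def)
        qed
        show "lookup x t = 0" if "size1 t = n" "\<not> coh t" for t
        proof -
          have "f t = 0"
            by (rule eq_0_incoherent[where f = f, OF 5 _ _ that]) (rule same inc; assumption)+
          then show ?thesis by (simp add: f_def)
        qed
      qed (use 5 in simp)
    qed
  qed
qed

theorem koszul_dual_As2: "koszul_dual (As2_rels arr) n = codual n"
  unfolding koszul_dual_def span_As2_rels
  using sub_cooperad_codual sub_cooperad_subset_codual by blast

end

lemma pcomp_eq_lin: "pcomp x i y = lin (\<lambda>s. lin (\<lambda>t. sng (graft s i t)) y) x"
  unfolding pcomp_def lin_def by (simp add: fv.scale_sum_right)

lemma pcomp_sng_left: "pcomp (sng s) i y = lin (\<lambda>t. sng (graft s i t)) y"
  and pcomp_sng_right: "pcomp x i (sng t) = lin (\<lambda>s. sng (graft s i t)) x"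
  by (simp_all add: pcomp_eq_lin)

lemma pcomp_in_free_op:
  assumes "x \<in> free_op m" "y \<in> free_op n" "1 \<le> i" "i \<le> m"
  shows "pcomp x i y \<in> free_op (m + n - 1)"
  unfolding pcomp_eq_lin
proof (intro lin_in_subspace[OF subspace_free_op])
  fix s t assume "s \<in> keys x" "t \<in> keys y"
  then show "sng (graft s i t) \<in> free_op (m + n - 1)"
    using assms by (simp add: free_op_def size1_graft)
qed

context two_param begin

section \<open>Normal forms\<close>

text \<open>Rotations performed down the right spine of the left factor. On normal arguments nothing
  else needs rewriting: the rotation keeps the first component \<open>c\<close>, under which
  \<open>l1\<close> is already irreducible.\<close>

fun mul :: "('w \<times> 'w) tree \<Rightarrow> 'w \<times> 'w \<Rightarrow> ('w \<times> 'w) tree \<Rightarrow> ('w \<times> 'w) tree" where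
  "mul \<langle>\<rangle> e r = \<langle>\<langle>\<rangle>, e, r\<rangle>"
| "mul \<langle>l1, (c, d), l2\<rangle> (a, b) r =
    (if a = c \<cdot> d then \<langle>l1, (c, d \<cdot> b), mul l2 (d, b) r\<rangle> else \<langle>\<langle>l1, (c, d), l2\<rangle>, (a, b), r\<rangle>)"

fun nf :: "('w \<times> 'w) tree \<Rightarrow> ('w \<times> 'w) tree" where
  "nf \<langle>\<rangle> = \<langle>\<rangle>"
| "nf \<langle>l, e, r\<rangle> = mul (nf l) e (nf r)"

fun reducible :: "('w \<times> 'w) tree \<Rightarrow> 'w \<Rightarrow> bool" where
  "reducible \<langle>\<rangle> a = False"
| "reducible \<langle>l, (c, d), r\<rangle> a = (a = c \<cdot> d)"

fun normal :: "('w \<times> 'w) tree \<Rightarrow> bool" where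
  "normal \<langle>\<rangle> = True"
| "normal \<langle>l, (a, b), r\<rangle> = (normal l \<and> normal r \<and> \<not> reducible l a)"

lemma size1_mul [simp]: "size1 (mul l e r) = size1 l + size1 r"
  by (induction l e r rule: mul.induct) auto

lemma size1_nf [simp]: "size1 (nf t) = size1 t"
  by (induction t) auto

text \<open>This takes the place of confluence. Along the right spine of \<open>x\<close> both sides
  rotate in parallel; where \<open>x\<close> admits no rotation, \<open>(a, b)\<close> labels a new
  root and one rotation there gives the equality.\<close>

lemma mul_assoc: "mul (mul x (a, b) y) (a \<cdot> b, c) z = mul x (a, b \<cdot> c) (mul y (b, c) z)"
proof (induction x "(a, b)" y arbitrary: a b rule: mul.induct)
  case (1 e r)
  then show ?case by simp
next
  case (2 l1 c' d l2 a b r)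
  then show ?case by (auto simp: assoc)
qed

lemma nf_mul: "nf (mul l e r) = mul (nf l) e (nf r)"
  by (induction l e r rule: mul.induct) (auto simp: mul_assoc)

lemma nf_nf [simp]: "nf (nf t) = nf t"
  by (induction t) (auto simp: nf_mul)

text \<open>A rotation keeps the leaves in their order, so the same leaf receives \<open>t\<close>
  before and after it, and \<open>mul_assoc\<close> identifies the two normal forms.\<close>

lemma nf_graft_mul: "nf (graft (mul l e r) i t) = nf (graft \<langle>l, e, r\<rangle> i t)"
proof (induction l e r arbitrary: i rule: mul.induct)
  case (2 l1 c d l2 a b r)
  show ?case
  proof (cases "a = c \<cdot> d")
    case True
    then show ?thesis
      using 2[OF True, of "i - size1 l1"] by (auto simp: nf_mul mul_assoc)
  qed simp
qed simp

lemma nf_graft_nf: "nf (graft (nf s) i (nf t)) = nf (graft s i t)"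
proof (induction s arbitrary: i)
  case (Node l e r)
  then show ?case by (simp add: nf_graft_mul)
qed simp

lemma mul_eq_Node: "\<not> reducible l a \<Longrightarrow> mul l (a, b) r = \<langle>l, (a, b), r\<rangle>"
  by (cases "(l, a)" rule: reducible.cases) auto

lemma normal_mul: "normal l \<Longrightarrow> normal r \<Longrightarrow> normal (mul l e r)"
  by (induction l e r rule: mul.induct) (auto elim: prod.exhaust)

lemma normal_nf [simp]: "normal (nf t)"
  by (induction t) (auto simp: normal_mul)

lemma nf_normal: "normal t \<Longrightarrow> nf t = t"
  by (induction t rule: normal.induct) (auto simp: mul_eq_Node)

section \<open>The ideal of relations\<close>

definition nfl :: "(('w \<times> 'w) tree \<Rightarrow>\<^sub>0 'k::field) \<Rightarrow> (('w \<times> 'w) tree \<Rightarrow>\<^sub>0 'k)" where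
  "nfl = lin (\<lambda>t. sng (nf t))"

lemma lin_nfl: "lin g (nfl x) = lin (\<lambda>t. g (nf t)) x"
  by (simp add: nfl_def lin_lin)

lemma nfl_pcomp:
  fixes x y :: "('w \<times> 'w) tree \<Rightarrow>\<^sub>0 'k::field"
  shows "nfl (pcomp x i y) = nfl (pcomp (nfl x) i (nfl y))"
proof -
  have "nfl (pcomp x i y) = lin (\<lambda>s. lin (\<lambda>t. sng (nf (graft s i t))) y) x"
    for x y :: "('w \<times> 'w) tree \<Rightarrow>\<^sub>0 'k"
    by (simp add: pcomp_eq_lin nfl_def lin_lin)
  then show ?thesis by (simp add: lin_nfl nf_graft_nf)
qed

lemma operadic_ideal_nfl: "operadic_ideal (\<lambda>n. {x \<in> free_op n. nfl x = (0 :: _ \<Rightarrow>\<^sub>0 'k::field)})"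
  unfolding operadic_ideal_def
proof (intro conjI allI impI)
  fix n show "fv.subspace {x \<in> free_op n. nfl x = (0 :: _ \<Rightarrow>\<^sub>0 'k)}"
    using subspace_free_op[of n, where 'k = 'k] unfolding fv.subspace_def by (auto simp: nfl_def lin_add lin_scale)
next
  fix m n i and x y :: "('w \<times> 'w) tree \<Rightarrow>\<^sub>0 'k"
  assume *: "1 \<le> i \<and> i \<le> m \<and> x \<in> free_op m \<and> y \<in> free_op n \<and>
    (x \<in> {x \<in> free_op m. nfl x = 0} \<or> y \<in> {x \<in> free_op n. nfl x = 0})"
  then have "pcomp (nfl x) i (nfl y) = 0" by (auto simp: pcomp_eq_lin lin_zero_fun)
  then have "nfl (pcomp x i y) = 0" by (subst nfl_pcomp) (simp add: nfl_def)
  then show "pcomp x i y \<in> {x \<in> free_op (m + n - 1). nfl x = 0}"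
    using * pcomp_in_free_op by blast
qed auto

lemma nfl_coword: "length w = 3 \<Longrightarrow> nfl (coword w) = 0"
proof -
  assume "length w = 3"
  then obtain \<alpha> \<beta> \<gamma> where w: "w = [\<alpha>, \<beta>, \<gamma>]" by (auto simp: numeral_3_eq_3 length_Suc_conv)
  show ?thesis
    unfolding w As2_rel_eq_coword[symmetric] nfl_def gen_def pcomp_single
    by (simp add: corolla_def lin_minus)
qed

text \<open>\<open>I\<close> is any competitor in the intersection defining
  \<open>rel_ideal\<close>; the aim is that it contains every difference
  \<open>sng t - sng (nf t)\<close>.\<close>

context
  fixes I :: "nat \<Rightarrow> (('w \<times> 'w) tree \<Rightarrow>\<^sub>0 'k::field) set"
  assumes I: "operadic_ideal I" and RI: "As2_rels arr \<subseteq> I 3"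
begin

lemma ideal_subspace: "fv.subspace (I n)" and ideal_free: "I n \<subseteq> free_op n"
  using I unfolding operadic_ideal_def by auto

lemma ideal_pcomp_left: "x \<in> I m \<Longrightarrow> y \<in> free_op n \<Longrightarrow> 1 \<le> i \<Longrightarrow> i \<le> m \<Longrightarrow> pcomp x i y \<in> I (m + n - 1)"
  and ideal_pcomp_right: "x \<in> free_op m \<Longrightarrow> y \<in> I n \<Longrightarrow> 1 \<le> i \<Longrightarrow> i \<le> m \<Longrightarrow> pcomp x i y \<in> I (m + n - 1)"
  using I ideal_free unfolding operadic_ideal_def by blast+

lemma sng_free_op: "sng t \<in> free_op (size1 t)"
  by (simp add: free_op_def)

lemma ideal_Node_left:
  assumes "sng l - sng l' \<in> I (size1 l)"
  shows "sng \<langle>l, e, r\<rangle> - sng \<langle>l', e, r\<rangle> \<in> I (size1 l + size1 r)"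
proof -
  have "pcomp (sng \<langle>\<langle>\<rangle>, e, r\<rangle>) 1 (sng l - sng l') \<in> I (size1 \<langle>\<langle>\<rangle>, e, r\<rangle> + size1 l - 1)"
    by (rule ideal_pcomp_right[OF sng_free_op assms]) auto
  then show ?thesis by (simp add: pcomp_sng_left lin_minus add.commute)
qed

lemma ideal_Node_right:
  assumes "sng r - sng r' \<in> I (size1 r)"
  shows "sng \<langle>l, e, r\<rangle> - sng \<langle>l, e, r'\<rangle> \<in> I (size1 l + size1 r)"
proof -
  have "pcomp (sng \<langle>l, e, \<langle>\<rangle>\<rangle>) (Suc (size1 l)) (sng r - sng r') \<in> I (size1 \<langle>l, e, \<langle>\<rangle>\<rangle> + size1 r - 1)"
    by (rule ideal_pcomp_right[OF sng_free_op assms]) auto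
  then show ?thesis by (simp add: pcomp_sng_left lin_minus)
qed

lemma ideal_rotation:
  "sng \<langle>\<langle>l1, (c, d), l2\<rangle>, (c \<cdot> d, b), r\<rangle> - sng \<langle>l1, (c, d \<cdot> b), \<langle>l2, (d, b), r\<rangle>\<rangle>
     \<in> I (size1 l1 + size1 l2 + size1 r)"
proof -
  let ?x = "sng \<langle>\<langle>\<langle>\<rangle>, (c, d), \<langle>\<rangle>\<rangle>, (c \<cdot> d, b), \<langle>\<rangle>\<rangle> - sng \<langle>\<langle>\<rangle>, (c, d \<cdot> b), \<langle>\<langle>\<rangle>, (d, b), \<langle>\<rangle>\<rangle>\<rangle>"
  have "?x = coword [c, d, b]"
    unfolding As2_rel_eq_coword[symmetric] gen_def pcomp_single by (simp add: corolla_def)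
  also have "\<dots> \<in> I 3" using RI unfolding As2_rels_eq by (rule subsetD) simp
  finally have "?x \<in> I 3" .
  \<comment> \<open>The leaves are filled from right to left, so that the numbers of those still to
    be filled do not shift.\<close>
  then have "pcomp ?x 3 (sng r) \<in> I (3 + size1 r - 1)"
    by (rule ideal_pcomp_left[OF _ sng_free_op]) auto
  then have "pcomp (pcomp ?x 3 (sng r)) 2 (sng l2) \<in> I (3 + size1 r - 1 + size1 l2 - 1)"
    by (rule ideal_pcomp_left[OF _ sng_free_op]) auto
  then have "pcomp (pcomp (pcomp ?x 3 (sng r)) 2 (sng l2)) 1 (sng l1)
      \<in> I (3 + size1 r - 1 + size1 l2 - 1 + size1 l1 - 1)"
    by (rule ideal_pcomp_left[OF _ sng_free_op]) (auto simp: size1_size)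
  then show ?thesis
    by (simp add: pcomp_sng_right lin_minus add_ac numeral_3_eq_3 numeral_2_eq_2)
qed

lemma ideal_trans: "x - y \<in> I n \<Longrightarrow> y - z \<in> I n \<Longrightarrow> x - z \<in> I n"
  using fv.subspace_add[OF ideal_subspace, of "x - y" n "y - z"] by simp

lemma ideal_zero: "0 \<in> I n"
  by (rule fv.subspace_0[OF ideal_subspace])

lemma ideal_mul: "sng \<langle>l, e, r\<rangle> - sng (mul l e r) \<in> I (size1 l + size1 r)"
proof (induction l e r rule: mul.induct)
  case (2 l1 c d l2 a b r)
  show ?case
  proof (cases "a = c \<cdot> d")
    case True
    have "sng \<langle>l1, (c, d \<cdot> b), \<langle>l2, (d, b), r\<rangle>\<rangle> - sng \<langle>l1, (c, d \<cdot> b), mul l2 (d, b) r\<rangle>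
        \<in> I (size1 l1 + size1 l2 + size1 r)"
      using ideal_Node_right[of "\<langle>l2, (d, b), r\<rangle>" "mul l2 (d, b) r"] 2[OF True] by (simp add: add.assoc)
    then show ?thesis using ideal_trans[OF ideal_rotation] True by simp
  qed (simp add: ideal_zero)
qed (simp add: ideal_zero)

lemma ideal_nf: "sng t - sng (nf t) \<in> I (size1 t)"
proof (induction t)
  case (Node l e r)
  have "sng \<langle>nf l, e, r\<rangle> - sng \<langle>nf l, e, nf r\<rangle> \<in> I (size1 l + size1 r)"
    using ideal_Node_right[OF Node(2), of "nf l" e] by simp
  moreover have "sng \<langle>nf l, e, nf r\<rangle> - sng (nf \<langle>l, e, r\<rangle>) \<in> I (size1 l + size1 r)"
    using ideal_mul[of "nf l" e "nf r"] by simp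
  ultimately show ?case using ideal_trans[OF ideal_trans[OF ideal_Node_left[OF Node(1)]]] by simp
qed (simp add: ideal_zero)

lemma nfl_kernel_subset: "x \<in> free_op n \<Longrightarrow> nfl x = 0 \<Longrightarrow> x \<in> I n"
proof -
  assume x: "x \<in> free_op n" "nfl x = 0"
  \<comment> \<open>This combination is \<open>x - nfl x\<close>, which is \<open>x\<close> on the
    kernel.\<close>
  have "lin (\<lambda>t. sng t - sng (nf t)) x \<in> I n"
    by (rule lin_in_subspace[OF ideal_subspace]) (use x ideal_nf in \<open>auto simp: free_op_def\<close>)
  then show ?thesis using x(2) by (simp add: lin_diff_fun nfl_def)
qed

end

lemma rel_ideal_As2: "rel_ideal (As2_rels arr) n = {x \<in> free_op n. nfl x = 0}"
proof
  have "As2_rels arr \<subseteq> {x \<in> free_op 3. nfl x = 0}"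
    unfolding As2_rels_eq using nfl_coword coword_in_codual codual_subset_free_op by blast
  then show "rel_ideal (As2_rels arr) n \<subseteq> {x \<in> free_op n. nfl x = 0}"
    unfolding rel_ideal_def using operadic_ideal_nfl by (blast intro: INT_lower)
  show "{x \<in> free_op n. nfl x = 0} \<subseteq> rel_ideal (As2_rels arr) n"
    unfolding rel_ideal_def using nfl_kernel_subset by blast
qed

section \<open>The Hilbert series\<close>

definition normals :: "nat \<Rightarrow> ('w \<times> 'w) tree set" where
  "normals n = {t. size1 t = n \<and> normal t}"

lemma finite_normals [simp]: "finite (normals n)"
  unfolding normals_def by (rule finite_subset[OF _ finite_size1[of n]]) auto

lemma nfl_normals: "(x :: _ \<Rightarrow>\<^sub>0 'k::field) \<in> fv.span (sng ` normals n) \<Longrightarrow> nfl x = x"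
  unfolding span_image_eq_lin
proof safe
  fix x :: "_ \<Rightarrow>\<^sub>0 'k" assume "keys x \<subseteq> normals n"
  then have "lin (\<lambda>t. sng (nf t)) x = lin sng x"
    by (intro lin_cong) (auto simp: normals_def nf_normal)
  then show "nfl (lin sng x) = lin sng x" by (simp add: nfl_def)
qed

lemma nfl_free_op: "nfl ` (free_op n :: (('w \<times> 'w) tree \<Rightarrow>\<^sub>0 'k::field) set) = fv.span (sng ` normals n)"
proof
  show "nfl ` (free_op n :: (('w \<times> 'w) tree \<Rightarrow>\<^sub>0 'k) set) \<subseteq> fv.span (sng ` normals n)"
    unfolding nfl_def
    by (intro image_subsetI lin_in_subspace[OF fv.subspace_span] fv.span_base imageI)
      (simp add: free_op_def normals_def)
  have "fv.span (sng ` normals n) \<subseteq> (free_op n :: (('w \<times> 'w) tree \<Rightarrow>\<^sub>0 'k) set)"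
    by (rule fv.span_minimal[OF _ subspace_free_op]) (auto simp: free_op_def normals_def)
  then show "fv.span (sng ` normals n) \<subseteq> nfl ` (free_op n :: (('w \<times> 'w) tree \<Rightarrow>\<^sub>0 'k) set)"
    using nfl_normals[where 'k = 'k, of _ n, symmetric] by (blast intro: image_eqI)
qed

lemma quot_basis_normals:
  "quot_basis (free_op n) {x \<in> free_op n. nfl x = 0} (sng ` normals n :: (_ \<Rightarrow>\<^sub>0 'k::field) set)"
  unfolding quot_basis_def
proof (intro conjI allI impI)
  show sub: "sng ` normals n \<subseteq> (free_op n :: (_ \<Rightarrow>\<^sub>0 'k) set)"
    by (auto simp: free_op_def normals_def)
  fix S :: "(_ \<Rightarrow>\<^sub>0 'k) set" and c
  assume *: "finite S \<and> S \<subseteq> sng ` normals n \<and> (\<Sum>b\<in>S. vscale (c b) b) \<in> {x \<in> free_op n. nfl x = 0}"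
  then have "(\<Sum>b\<in>S. vscale (c b) b) \<in> fv.span (sng ` normals n)"
    by (intro fv.span_sum fv.span_scale fv.span_base) blast
  from nfl_normals[OF this] have "(\<Sum>b\<in>S. vscale (c b) b) = 0" using * by simp
  then show "\<forall>b\<in>S. c b = 0"
    using fv.independent_explicit_module[THEN iffD1, OF independent_sng[of "normals n"], rule_format, of S c] *
    by simp
next
  show "(free_op n :: (_ \<Rightarrow>\<^sub>0 'k) set) \<subseteq> fv.span (sng ` normals n \<union> {x \<in> free_op n. nfl x = 0})"
  proof
    fix x :: "('w \<times> 'w) tree \<Rightarrow>\<^sub>0 'k" assume x: "x \<in> free_op n"
    have 1: "nfl x \<in> fv.span (sng ` normals n)" unfolding nfl_free_op[symmetric] using x by (rule imageI)
    have "fv.span (sng ` normals n) \<subseteq> (free_op n :: (_ \<Rightarrow>\<^sub>0 'k) set)"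
      by (rule fv.span_minimal[OF _ subspace_free_op]) (auto simp: free_op_def normals_def)
    then have "x - nfl x \<in> free_op n"
      using 1 by (intro fv.subspace_diff[OF subspace_free_op] x) (rule subsetD)
    moreover have "nfl (x - nfl x) = 0" using nfl_normals[OF 1] by (simp add: nfl_def lin_minus)
    ultimately have "x - nfl x \<in> fv.span (sng ` normals n \<union> {x \<in> free_op n. nfl x = 0})"
      by (intro fv.span_base) simp
    moreover have "nfl x \<in> fv.span (sng ` normals n \<union> {x \<in> free_op n. nfl x = 0})"
      by (rule subsetD[OF fv.span_mono 1]) simp
    ultimately have "x - nfl x + nfl x \<in> fv.span (sng ` normals n \<union> {x \<in> free_op n. nfl x = 0})"
      by (rule fv.span_add)
    then show "x \<in> fv.span (sng ` normals n \<union> {x \<in> free_op n. nfl x = 0})" by simp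
  qed
qed

lemma operad_dim_As2:
  "operad_dim (As2_rels arr :: (_ \<Rightarrow>\<^sub>0 'k::field) set) n = card (normals n)"
proof -
  let ?W = "{x \<in> free_op n. nfl x = (0 :: _ \<Rightarrow>\<^sub>0 'k)}"
  define B where "B = (SOME B. quot_basis (free_op n) ?W B)"
  have "quot_basis (free_op n) ?W B"
    unfolding B_def by (rule someI[where P = "quot_basis (free_op n) ?W", OF quot_basis_normals])
  then have "card B = card (normals n)"
    unfolding nfl_def
    by (rule quot_basis_card[OF finite_normals _ subspace_free_op nfl_free_op[unfolded nfl_def]])
  then show ?thesis
    unfolding operad_dim_def quot_dim_def rel_ideal_As2 B_def .
qed

lemma normals_1: "normals 1 = {\<langle>\<rangle>}"
proof (rule set_eqI)
  fix t show "t \<in> normals 1 \<longleftrightarrow> t \<in> {\<langle>\<rangle>}"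
    by (cases "t = \<langle>\<rangle>") (simp_all add: normals_def size1_size)
qed

text \<open>Exactly one first component makes the edge to a nontrivial left subtree rotatable; a
  leaf forbids nothing. This is the source of the factor \<open>\<omega> - 1\<close>.\<close>

lemma card_not_reducible:
  "card {a. \<not> reducible t a} = (if t = \<langle>\<rangle> then card (UNIV :: 'w set) else card (UNIV :: 'w set) - 1)"
proof (cases t)
  case (Node l e r)
  obtain c d where "e = (c, d)" by fastforce
  then have "{a. \<not> reducible t a} = UNIV - {c \<cdot> d}" using Node by auto
  then show ?thesis using Node by (simp add: card_Diff_singleton)
qed simp

lemma card_normals_rec:
  assumes n: "n \<ge> 2"
  shows "card (normals n) = card (UNIV :: 'w set) * (card (UNIV :: 'w set) - 1) * (\<Sum>k=1..n-1. card (normals k) * card (normals (n - k)))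
    + card (UNIV :: 'w set) * card (normals (n - 1))"
proof -
  define \<omega> where "\<omega> = card (UNIV :: 'w set)"
  have \<omega>: "\<omega> \<ge> 1" unfolding \<omega>_def by (simp add: Suc_le_eq card_gt_0_iff)
  define F where "F k = (SIGMA l:normals k. {a. \<not> reducible l a} \<times> (UNIV :: 'w set) \<times> normals (n - k))" for k
  define node where "node = (\<lambda>(l, a :: 'w, b :: 'w, r). \<langle>l, (a, b), r\<rangle>)"
  have eq: "normals n = node ` (\<Union>k\<in>{1..n-1}. F k)"
  proof (intro set_eqI iffI)
    fix t assume t: "t \<in> normals n"
    then obtain l a b r where t': "t = \<langle>l, (a, b), r\<rangle>" using n by (cases t) (auto simp: normals_def)
    have "size1 l \<in> {1..n-1}" "(l, a, b, r) \<in> F (size1 l)"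
      using t t' by (auto simp: F_def normals_def size1_size)
    then show "t \<in> node ` (\<Union>k\<in>{1..n-1}. F k)" using t' by (force simp: node_def)
  qed (use n in \<open>auto simp: node_def F_def normals_def\<close>)
  have inj: "inj node" by (auto simp: inj_def node_def)
  \<comment> \<open>Over a left leaf one more first component is allowed; with the free second
    component this adds \<open>\<omega>\<close> choices of label when \<open>k = 1\<close>.\<close>
  have cF: "card (F k) = (\<omega> * (\<omega> - 1)) * (card (normals k) * card (normals (n - k)))
      + (if k = 1 then \<omega> * card (normals (n - 1)) else 0)" if "k \<in> {1..n-1}" for k
  proof -
    have "card (F k) = (\<Sum>l\<in>normals k. card {a. \<not> reducible l a} * (\<omega> * card (normals (n - k))))"
      unfolding F_def \<omega>_def by (simp add: card_SigmaI card_cartesian_product)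
    also have "\<dots> = (\<Sum>l\<in>normals k. (if k = 1 then \<omega> else \<omega> - 1) * (\<omega> * card (normals (n - k))))"
      unfolding card_not_reducible \<omega>_def
      by (rule sum.cong) (use that in \<open>auto simp: normals_def size1_size\<close>)
    also have "\<dots> = card (normals k) * ((if k = 1 then \<omega> else \<omega> - 1) * (\<omega> * card (normals (n - k))))"
      by simp
    also have "\<dots> = (\<omega> * (\<omega> - 1)) * (card (normals k) * card (normals (n - k)))
      + (if k = 1 then \<omega> * card (normals (n - 1)) else 0)"
    proof (cases "k = 1")
      case True
      obtain \<omega>' where "\<omega> = Suc \<omega>'" using \<omega> by (cases \<omega>) auto
      then show ?thesis using True normals_1 by (simp add: algebra_simps)
    qed (simp add: ac_simps)
    finally show ?thesis .
  qed
  have "card (normals n) = card (\<Union>k\<in>{1..n-1}. F k)"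
    unfolding eq by (rule card_image[OF inj_on_subset[OF inj subset_UNIV]])
  also have "\<dots> = (\<Sum>k=1..n-1. card (F k))"
  proof (rule card_UN_disjoint)
    show "\<forall>k\<in>{1..n-1}. finite (F k)"
      unfolding F_def by (intro ballI finite_SigmaI finite_cartesian_product finite_normals) simp_all
  qed (auto simp: F_def normals_def)
  also have "\<dots> = (\<Sum>k=1..n-1. (\<omega> * (\<omega> - 1)) * (card (normals k) * card (normals (n - k)))
      + (if k = 1 then \<omega> * card (normals (n - 1)) else 0))"
    by (rule sum.cong) (use cF in auto)
  also have "\<dots> = \<omega> * (\<omega> - 1) * (\<Sum>k=1..n-1. card (normals k) * card (normals (n - k)))
    + \<omega> * card (normals (n - 1))"
    using n by (simp add: sum.distrib sum_distrib_left)
  finally show ?thesis unfolding \<omega>_def .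
qed

end

section \<open>Closed form of the generating series\<close>

lemma fps_sqrt_unique:
  fixes a b :: "'a::field_char_0 fps"
  assumes "b ^ 2 = a" "fps_nth b 0 = 1"
  shows "fps_sqrt a = b"
proof -
  have a0: "fps_nth a 0 = 1" using assms by (auto simp: power2_eq_square)
  have "(fps_sqrt a - b) * (fps_sqrt a + b) = 0"
    using fps_sqrt_power2[OF a0] assms(1) by (simp add: algebra_simps power2_eq_square)
  moreover have "fps_nth (fps_sqrt a + b) 0 \<noteq> 0" using assms(2) by (simp add: fps_sqrt_nth_0)
  then have "fps_sqrt a + b \<noteq> 0" by (metis fps_zero_nth)
  ultimately show ?thesis by auto
qed

text \<open>The recursion is the quadratic equation
  \<open>P = X + \<omega>(\<omega> - 1) P^2 + \<omega> X P\<close>, solved by completing the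
  square.\<close>

lemma quadratic_recursion_fps:
  fixes p :: "nat \<Rightarrow> nat" and \<omega> :: nat
  defines "P \<equiv> Abs_fps (\<lambda>n. if n = 0 then 0 else of_nat (p n)) :: rat fps"
  assumes p1: "p 1 = 1" and \<omega>: "\<omega> \<ge> 2"
    and rec: "\<And>n. n \<ge> 2 \<Longrightarrow> p n = \<omega> * (\<omega> - 1) * (\<Sum>k=1..n-1. p k * p (n - k)) + \<omega> * p (n - 1)"
  shows "P = (1 - fps_const (of_nat \<omega>) * fps_X
             - fps_sqrt (1 + fps_const (2 * of_nat \<omega> * (1 - 2 * of_nat \<omega>)) * fps_X
                           + fps_const ((of_nat \<omega>)\<^sup>2) * fps_X\<^sup>2))
          / fps_const (2 * of_nat \<omega> * (of_nat \<omega> - 1))"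
proof -
  define w :: rat where "w = of_nat \<omega>"
  have w1: "of_nat (\<omega> - 1) = w - 1" using \<omega> by (simp add: w_def of_nat_diff)
  have PP: "fps_nth (P * P) n = of_nat (\<Sum>k=1..n-1. p k * p (n - k))" for n
  proof -
    have "fps_nth (P * P) n = (\<Sum>k=0..n. fps_nth P k * fps_nth P (n - k))" by (rule fps_mult_nth)
    also have "\<dots> = (\<Sum>k=1..n-1. fps_nth P k * fps_nth P (n - k))"
      by (rule sum.mono_neutral_right) (auto simp: P_def)
    also have "\<dots> = (\<Sum>k=1..n-1. of_nat (p k * p (n - k)))"
      by (rule sum.cong) (auto simp: P_def)
    finally show ?thesis by simp
  qed
  have P: "P = fps_X + fps_const (w * (w - 1)) * (P * P) + fps_const w * (fps_X * P)"
  proof (rule fps_ext)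
    fix n :: nat
    consider "n = 0" | "n = 1" | "n \<ge> 2" by linarith
    then show "fps_nth P n = fps_nth (fps_X + fps_const (w * (w - 1)) * (P * P) + fps_const w * (fps_X * P)) n"
    proof cases
      case 3
      have "fps_nth P n = of_nat (p n)" using 3 by (simp add: P_def)
      also have "\<dots> = w * (w - 1) * fps_nth (P * P) n + w * fps_nth P (n - 1)"
        unfolding rec[OF 3] PP of_nat_add of_nat_mult w1 using 3 by (simp add: P_def w_def)
      finally show ?thesis using 3 by simp
    qed (simp_all add: PP, simp_all add: P_def p1[unfolded One_nat_def])
  qed
  define c where "c = fps_const (2 * w * (w - 1))"
  \<comment> \<open>Up to sign, the derivative of the quadratic equation with respect to
    \<open>P\<close>: its square is the discriminant, and its constant coefficient 1 selects the
    branch of the root.\<close>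
  define Q where "Q = 1 - fps_const w * fps_X - c * P"
  \<comment> \<open>The last bracket is the quadratic equation moved to one side, so it vanishes for
    the series \<open>P\<close>.\<close>
  have ring: "(1 - W * X - 2 * W * (W - 1) * P) ^ 2 = 1 + 2 * W * (1 - 2 * W) * X + W ^ 2 * X ^ 2
      + 4 * W * (W - 1) * (X + W * (W - 1) * (P * P) + W * (X * P) - P)" for W X P :: "rat fps"
    by algebra
  have "Q ^ 2 = 1 + fps_const (2 * w * (1 - 2 * w)) * fps_X + fps_const (w\<^sup>2) * fps_X\<^sup>2"
  proof -
    let ?W = "fps_const w" and ?X = "fps_X :: rat fps"
    have two: "(2 :: rat fps) = fps_const 2" by (simp add: numeral_fps_const)
    have c: "c = 2 * ?W * (?W - 1)"
      by (simp only: c_def two fps_const_mult fps_const_sub fps_const_1_eq_1[symmetric])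
    have k: "fps_const (w * (w - 1)) = ?W * (?W - 1)" "fps_const (2 * w * (1 - 2 * w)) = 2 * ?W * (1 - 2 * ?W)"
      "fps_const (w\<^sup>2) = ?W ^ 2"
      by (simp_all only: two fps_const_mult fps_const_sub power2_eq_square fps_const_1_eq_1[symmetric])
    have "Q ^ 2 = 1 + 2 * ?W * (1 - 2 * ?W) * ?X + ?W ^ 2 * ?X ^ 2
        + 4 * ?W * (?W - 1) * (?X + ?W * (?W - 1) * (P * P) + ?W * (?X * P) - P)"
      unfolding Q_def c by (rule ring)
    also have "?X + ?W * (?W - 1) * (P * P) + ?W * (?X * P) - P = 0" using P unfolding k by simp
    finally show ?thesis unfolding k by simp
  qed
  moreover have "fps_nth Q 0 = 1" by (simp add: Q_def P_def)
  ultimately have "fps_sqrt (1 + fps_const (2 * w * (1 - 2 * w)) * fps_X + fps_const (w\<^sup>2) * fps_X\<^sup>2) = Q"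
    by (rule fps_sqrt_unique)
  moreover have "c \<noteq> 0" using \<omega> by (simp add: c_def w_def)
  then have "P = c * P / c" by simp
  ultimately show ?thesis unfolding Q_def c_def w_def by simp
qed

section \<open>Multilinear expansion of tensors\<close>

text \<open>Expanding one factor at a time allows rewriting slot by slot, which a single sum over
  \<open>listset\<close> does not.\<close>

fun mlin :: "('a list \<Rightarrow> ('b \<Rightarrow>\<^sub>0 'k::field)) \<Rightarrow> ('a \<Rightarrow>\<^sub>0 'k) list \<Rightarrow> ('b \<Rightarrow>\<^sub>0 'k)" where
  "mlin g [] = g []"
| "mlin g (y # ys) = lin (\<lambda>f. mlin (\<lambda>fs. g (f # fs)) ys) y"

lemma mlin_eq_sum:
  "(\<Sum>fs\<in>listset (map keys ys). vscale (prod_list (map2 lookup ys fs)) (g fs)) = mlin g ys"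
proof (induction ys arbitrary: g)
  case (Cons y ys)
  have "listset (map keys (y # ys)) = (\<lambda>(f, fs). f # fs) ` (keys y \<times> listset (map keys ys))"
    by (auto simp: set_Cons_def)
  moreover have "inj_on (\<lambda>(f, fs). f # fs) (keys y \<times> listset (map keys ys))"
    by (auto simp: inj_on_def)
  ultimately have "(\<Sum>fs\<in>listset (map keys (y # ys)). vscale (prod_list (map2 lookup (y # ys) fs)) (g fs)) =
     (\<Sum>(f, fs)\<in>keys y \<times> listset (map keys ys).
        vscale (lookup y f) (vscale (prod_list (map2 lookup ys fs)) (g (f # fs))))"
    by (simp add: sum.reindex case_prod_unfold)
  also have "\<dots> = (\<Sum>f\<in>keys y. vscale (lookup y f) (mlin (\<lambda>fs. g (f # fs)) ys))"
    by (simp add: sum.cartesian_product[symmetric] fv.scale_sum_right[symmetric] Cons del: fv.scale_scale)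
  finally show ?case by (simp add: lin_def)
qed simp

lemma tensors_eq_mlin: "tensors x ys = mlin (\<lambda>fs. lin (\<lambda>c. sng (c, fs)) x) ys"
  unfolding mlin_eq_sum[symmetric] tensors_def
  by (subst sum.swap) (simp add: lin_def fv.scale_sum_right mult.commute)

lemma mlin_sng [simp]: "mlin g (map sng fs) = g fs"
  by (induction fs arbitrary: g) simp_all

lemma mlin_sng_append: "mlin g (map sng fs @ ys) = mlin (\<lambda>fs'. g (fs @ fs')) ys"
  by (induction fs arbitrary: g) simp_all

lemma lin_mlin: "lin F (mlin g ys) = mlin (\<lambda>fs. lin F (g fs)) ys"
  by (induction ys arbitrary: g) (simp_all add: lin_lin)

lemma mlin_zero: "0 \<in> set ys \<Longrightarrow> mlin g ys = 0"
  by (induction ys arbitrary: g) (auto intro: lin_zero_fun)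

lemma mlin_in_subspace:
  "fv.subspace S \<Longrightarrow> (\<And>fs. list_all2 (\<lambda>f y. f \<in> keys y) fs ys \<Longrightarrow> g fs \<in> S) \<Longrightarrow> mlin g ys \<in> S"
proof (induction ys arbitrary: g)
  case (Cons y ys)
  show ?case
    unfolding mlin.simps by (intro lin_in_subspace Cons) simp_all
qed simp

section \<open>The bar complex of an associative product\<close>

definition merge :: "('a \<Rightarrow> 'a \<Rightarrow> 'a) \<Rightarrow> nat \<Rightarrow> 'a list \<Rightarrow> 'a list" where
  "merge f i xs = take i xs @ f (xs ! i) (xs ! Suc i) # drop (Suc (Suc i)) xs"

lemma merge_simps [simp]:
  "merge f 0 (x # y # xs) = f x y # xs"
  "merge f (Suc i) (x # xs) = x # merge f i xs"
  by (simp_all add: merge_def)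

text \<open>The bar differential in a form suited to induction on the list;
  \<open>bar_eq_sum\<close> recovers the alternating sum of products of neighbours.\<close>

fun bar :: "('a \<Rightarrow> 'a \<Rightarrow> 'a) \<Rightarrow> 'a list \<Rightarrow> ('a list \<Rightarrow>\<^sub>0 'k::field)" where
  "bar f (x # y # xs) = sng (f x y # xs) - lin (\<lambda>l. sng (x # l)) (bar f (y # xs))"
| "bar f xs = 0"

lemma bar_eq_sum:
  "bar f xs = (\<Sum>i<length xs - 1. vscale ((- 1) ^ i) (sng (merge f i xs)) :: _ \<Rightarrow>\<^sub>0 'k::field)"
proof (induction xs rule: induct_list012)
  case (3 x y xs)
  have "bar f (x # y # xs) = sng (merge f 0 (x # y # xs)) +
     (\<Sum>i<length xs. vscale ((- 1) ^ Suc i) (sng (merge f (Suc i) (x # y # xs))) :: _ \<Rightarrow>\<^sub>0 'k)"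
    using 3(2) by (simp add: lin_sum single_uminus sum_negf)
  also have "\<dots> = (\<Sum>i<Suc (length xs). vscale ((- 1) ^ i) (sng (merge f i (x # y # xs))))"
    by (subst sum.lessThan_Suc_shift) simp
  finally show ?case by simp
qed simp_all

lemma keys_minus_subset: "keys (x - y) \<subseteq> keys x \<union> keys (y :: 'a \<Rightarrow>\<^sub>0 'k::field)"
  by (auto simp: in_keys_iff lookup_minus)

lemma keys_bar:
  assumes "ys \<in> keys (bar f xs :: _ \<Rightarrow>\<^sub>0 'k::field)" and g: "\<And>x y. g (f x y) = g x + (g y :: nat)"
  shows "Suc (length ys) = length xs \<and> 2 \<le> length xs \<and> sum_list (map g ys) = sum_list (map g xs)"
  using assms(1)
proof (induction xs arbitrary: ys rule: induct_list012)
  case (3 x y xs)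
  then have "ys = f x y # xs \<or> (\<exists>l \<in> keys (bar f (y # xs) :: _ \<Rightarrow>\<^sub>0 'k). ys = x # l)"
    using keys_minus_subset[of "sng (f x y # xs) :: _ \<Rightarrow>\<^sub>0 'k"]
      keys_lin[of "\<lambda>l. sng (x # l)" "bar f (y # xs) :: _ \<Rightarrow>\<^sub>0 'k"]
    by fastforce
  then show ?case using 3(2) g by auto
qed auto

lemma bar_Cons:
  "l \<noteq> [] \<Longrightarrow> bar f (x # l) = sng (f x (hd l) # tl l) - lin (\<lambda>l. sng (x # l)) (bar f l)"
  by (cases l) auto

lemma bar_bar:
  assumes f: "\<And>x y z. f (f x y) z = f x (f y z)"
  shows "lin (bar f) (bar f xs) = (0 :: _ \<Rightarrow>\<^sub>0 'k::field)"
proof (induction xs rule: induct_list012)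
  case (3 x y xs)
  \<comment> \<open>By associativity, left multiplication of the first entry by \<open>x\<close>
    commutes with the differential; the resulting term cancels against the differential of the list
    starting with \<open>f x y\<close>.\<close>
  have act: "lin (\<lambda>l. sng (f x (hd l) # tl l)) (bar f (y # xs)) = (bar f (f x y # xs) :: _ \<Rightarrow>\<^sub>0 'k)"
    by (cases xs) (simp_all add: lin_minus lin_lin f)
  have "lin (\<lambda>l. bar f (x # l)) (bar f (y # xs)) =
      lin (\<lambda>l. sng (f x (hd l) # tl l) - lin (\<lambda>l. sng (x # l)) (bar f l)) (bar f (y # xs) :: _ \<Rightarrow>\<^sub>0 'k)"
    using keys_bar[where g = "\<lambda>_. 0"] by (intro lin_cong bar_Cons) fastforce
  also have "\<dots> = bar f (f x y # xs) - lin (\<lambda>l. sng (x # l)) (lin (bar f) (bar f (y # xs)))"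
    by (simp only: lin_diff_fun act lin_lin)
  also have "\<dots> = bar f (f x y # xs)" by (simp add: 3(2))
  finally show ?case by (simp add: lin_minus lin_lin)
qed simp_all

context two_param begin

section \<open>The Koszul complex as a bar complex\<close>

text \<open>Two-parameters associativity of the products on trees is associativity of the product
  \<open>nprod\<close> on pairs of a tree and an element of the semigroup; a tensor
  \<open>coword w \<otimes> f\<^sub>1 \<otimes> \<dots> \<otimes> f\<^sub>k\<close> is the list of the pairs \<open>(f\<^sub>i, w\<^sub>i)\<close>.\<close>

definition emb :: "(('w \<times> 'w) tree \<times> 'w) list \<Rightarrow> (('w \<times> 'w) tree \<times> ('w \<times> 'w) tree list \<Rightarrow>\<^sub>0 'k::field)" where
  "emb xs = lin (\<lambda>c. sng (c, map fst xs)) (coword (map snd xs))"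

definition words :: "nat \<Rightarrow> nat \<Rightarrow> (('w \<times> 'w) tree \<times> 'w) list set" where
  "words k n = {xs. length xs = k \<and> sum_list (map (\<lambda>x. size1 (fst x)) xs) = n}"

text \<open>The differential acts on representatives in the free operad, hence through
  \<open>tprod\<close>; associativity appears only after normalisation, for
  \<open>nprod\<close>.\<close>

fun tprod nprod :: "('w \<times> 'w) tree \<times> 'w \<Rightarrow> ('w \<times> 'w) tree \<times> 'w \<Rightarrow> ('w \<times> 'w) tree \<times> 'w" where
  "tprod (s, a) (t, b) = (\<langle>s, (a, b), t\<rangle>, a \<cdot> b)"
| "nprod (s, a) (t, b) = (mul s (a, b) t, a \<cdot> b)"

abbreviation nfs :: "(('w \<times> 'w) tree \<times> 'w) list \<Rightarrow> (('w \<times> 'w) tree \<times> 'w) list" where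
  "nfs \<equiv> map (apfst nf)"

lemma nprod_assoc: "nprod (nprod x y) z = nprod x (nprod y z)"
  by (cases x; cases y; cases z) (simp add: mul_assoc assoc)

lemma size1_tprod: "size1 (fst (tprod x y)) = size1 (fst x) + size1 (fst y)"
  and size1_nprod: "size1 (fst (nprod x y)) = size1 (fst x) + size1 (fst y)"
  by (cases x; cases y; simp)+

lemma nfs_bar: "lin (\<lambda>l. sng (nfs l)) (bar tprod xs) = (bar nprod (nfs xs) :: _ \<Rightarrow>\<^sub>0 'k::field)"
proof (induction xs rule: induct_list012)
  case (3 x y xs)
  have "apfst nf (tprod x y) = nprod (apfst nf x) (apfst nf y)"
    by (cases x; cases y) simp
  moreover have "lin (\<lambda>l. sng (apfst nf x # l)) (bar nprod (nfs (y # xs))) =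
      lin (\<lambda>l. sng (apfst nf x # nfs l)) (bar tprod (y # xs) :: _ \<Rightarrow>\<^sub>0 'k)"
    unfolding 3(2)[symmetric] by (simp add: lin_lin)
  ultimately show ?case by (simp add: lin_minus lin_lin)
qed simp_all

lemma lookup_emb:
  "lookup (emb xs :: _ \<Rightarrow>\<^sub>0 'k::field) (c, fs) = (if map fst xs = fs \<and> lab c (map snd xs) then tsign c else 0)"
proof -
  have "lookup (emb xs :: _ \<Rightarrow>\<^sub>0 'k) (c, fs) =
      (\<Sum>t\<in>keys (coword (map snd xs) :: _ \<Rightarrow>\<^sub>0 'k). if t = c then (if map fst xs = fs then lookup (coword (map snd xs)) c else 0) else 0)"
    unfolding emb_def lookup_lin by (rule sum.cong) (auto simp: lookup_single when_def)
  then show ?thesis by (simp add: in_keys_iff lookup_coword)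
qed

lemma emb_eq_sum:
  "emb xs = (\<Sum>c | lab c (map snd xs). Poly_Mapping.single (c, map fst xs) (tsign c))"
  by (simp add: emb_def coword_def lin_sum)

lemma lin_tree_codual:
  assumes "x \<in> codual k" "length fs = k" "sum_list (map size1 fs) = n"
  shows "lin (\<lambda>c. sng (c, fs)) x \<in> fv.span (emb ` words k n)"
proof -
  obtain u where u: "x = lin coword u" "keys u \<subseteq> {w. length w = k}"
    using assms(1) unfolding codual_def span_image_eq_lin by blast
  have "lin (\<lambda>c. sng (c, fs)) (coword w) \<in> fv.span (emb ` words k n)" if "w \<in> keys u" for w
  proof -
    have w: "length w = length fs" using u(2) that assms(2) by blast
    have "map (\<lambda>x. size1 (fst x)) (zip fs w) = map size1 (map fst (zip fs w))" by simp
    also have "\<dots> = map size1 fs" using w by simp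
    finally have "zip fs w \<in> words k n" using w assms by (simp add: words_def)
    moreover have "lin (\<lambda>c. sng (c, fs)) (coword w) = emb (zip fs w)" using w by (simp add: emb_def)
    ultimately show ?thesis by (auto intro: fv.span_base)
  qed
  then show ?thesis unfolding u(1) lin_lin by (rule lin_in_subspace[OF fv.subspace_span])
qed

lemma emb_eq_tensors: "emb xs = tensors (coword (map snd xs)) (map sng (map fst xs))"
  unfolding tensors_eq_mlin mlin_sng emb_def ..

lemma kos_chain_As2: "kos_chain (As2_rels arr :: (_ \<Rightarrow>\<^sub>0 'a::field) set) k n = fv.span (emb ` words k n)"
proof
  show "kos_chain (As2_rels arr :: (_ \<Rightarrow>\<^sub>0 'a) set) k n \<subseteq> fv.span (emb ` words k n)"
    unfolding kos_chain_def koszul_dual_As2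
  proof (rule fv.span_minimal[OF _ fv.subspace_span], clarify)
    fix x :: "_ \<Rightarrow>\<^sub>0 'a" and ys :: "(('w \<times> 'w) tree \<Rightarrow>\<^sub>0 'a) list" and ns
    assume *: "x \<in> codual (length ns)" "list_all2 (\<lambda>y m. y \<in> free_op m) ys ns"
    show "tensors x ys \<in> fv.span (emb ` words (length ns) (sum_list ns))"
      unfolding tensors_eq_mlin
    proof (rule mlin_in_subspace[OF fv.subspace_span])
      fix fs assume "list_all2 (\<lambda>f y. f \<in> keys y) fs ys"
      then have "map size1 fs = ns"
        using *(2) by (intro nth_equalityI) (auto simp: list_all2_conv_all_nth free_op_def)
      moreover from this have "length fs = length ns" by auto
      ultimately show "lin (\<lambda>c. sng (c, fs)) x \<in> fv.span (emb ` words (length ns) (sum_list ns))"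
        using *(1) by (intro lin_tree_codual) simp_all
    qed
  qed
  show "fv.span (emb ` words k n) \<subseteq> kos_chain (As2_rels arr :: (_ \<Rightarrow>\<^sub>0 'a) set) k n"
    unfolding kos_chain_def koszul_dual_As2
  proof (rule fv.span_mono, clarify)
    fix xs assume xs: "xs \<in> words k n"
    let ?ns = "map (\<lambda>x. size1 (fst x)) xs"
    show "\<exists>x ys ns. emb xs = tensors x ys \<and> x \<in> codual k \<and> length ns = k \<and> sum_list ns = n \<and>
        list_all2 (\<lambda>y m. y \<in> free_op m) ys ns"
      by (rule exI[of _ "coword (map snd xs)"], rule exI[of _ "map sng (map fst xs)"], rule exI[of _ ?ns])
        (use xs in \<open>auto simp: words_def emb_eq_tensors coword_in_codual list_all2_conv_all_nth free_op_def\<close>)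
  qed
qed

section \<open>Null chains as the kernel of normalisation\<close>

definition nft :: "(('w \<times> 'w) tree \<times> ('w \<times> 'w) tree list \<Rightarrow>\<^sub>0 'k::field) \<Rightarrow> _" where
  "nft = lin (\<lambda>(c, fs). sng (c, map nf fs))"

lemma nft_emb: "nft (emb xs) = emb (nfs xs)"
  by (simp add: nft_def emb_def lin_lin comp_def)

lemma mlin_nf: "mlin (\<lambda>fs. g (map nf fs)) ys = mlin g (map nfl ys)"
proof (induction ys arbitrary: g)
  case (Cons y ys)
  show ?case by (simp add: lin_nfl Cons[of "\<lambda>fs. g (nf _ # fs)"])
qed simp

lemma nft_tensors_zero:
  assumes "j < length ys" "nfl (ys ! j) = 0"
  shows "nft (tensors x ys) = 0"
proof -
  have "nft (tensors x ys) = mlin (\<lambda>fs. lin (\<lambda>c. sng (c, map nf fs)) x) ys"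
    by (simp add: nft_def tensors_eq_mlin lin_mlin lin_lin)
  also have "\<dots> = mlin (\<lambda>fs. lin (\<lambda>c. sng (c, fs)) x) (map nfl ys)" by (rule mlin_nf)
  also have "\<dots> = 0" using assms by (intro mlin_zero) (metis length_map nth_map nth_mem)
  finally show ?thesis .
qed

text \<open>The difference is a tensor having \<open>sng t - sng (nf t)\<close>, an element of the
  ideal, in one slot and basis trees in the others.\<close>

lemma emb_nf_in_kos_null:
  assumes "pre @ (t, a) # xs \<in> words k n"
  shows "emb (pre @ (t, a) # xs) - emb (pre @ (nf t, a) # xs)
    \<in> (kos_null (As2_rels arr) k n :: (_ \<Rightarrow>\<^sub>0 'k::field) set)"
proof -
  let ?y = "sng t - sng (nf t) :: _ \<Rightarrow>\<^sub>0 'k"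
  let ?ys = "map sng (map fst pre) @ ?y # map sng (map fst xs)"
  let ?ns = "map (\<lambda>x. size1 (fst x)) (pre @ (t, a) # xs)"
  let ?x = "coword (map snd pre @ a # map snd xs) :: _ \<Rightarrow>\<^sub>0 'k"
  have y: "?y \<in> rel_ideal (As2_rels arr) (size1 t)"
    unfolding rel_ideal_As2 using fv.subspace_diff[OF subspace_free_op, of "sng t" "size1 t" "sng (nf t)"]
    by (auto simp: free_op_def nfl_def lin_minus)
  then have yf: "?y \<in> free_op (size1 t)" unfolding rel_ideal_As2 by blast
  have "tensors ?x ?ys = lin (\<lambda>f. lin (\<lambda>c. sng (c, map fst pre @ f # map fst xs)) ?x) ?y"
    unfolding tensors_eq_mlin mlin_sng_append by (simp del: map_map)
  also have "\<dots> = emb (pre @ (t, a) # xs) - emb (pre @ (nf t, a) # xs)"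
    by (simp add: lin_minus emb_def)
  finally have "emb (pre @ (t, a) # xs) - emb (pre @ (nf t, a) # xs) = tensors ?x ?ys" by simp
  moreover have "?x \<in> koszul_dual (As2_rels arr) k"
    unfolding koszul_dual_As2 using assms by (intro coword_in_codual) (simp add: words_def)
  moreover have "length ?ns = k" "sum_list ?ns = n" using assms by (auto simp: words_def)
  moreover have "list_all2 (\<lambda>y m. y \<in> free_op m) ?ys ?ns"
  proof -
    have "list_all2 (\<lambda>y m. y \<in> free_op m) (map (\<lambda>x. sng (fst x) :: _ \<Rightarrow>\<^sub>0 'k) l) (map (\<lambda>x. size1 (fst x)) l)"
      for l :: "(('w \<times> 'w) tree \<times> 'w) list"
      by (simp add: list_all2_conv_all_nth free_op_def)
    then show ?thesis using yf by (auto intro!: list_all2_appendI simp: comp_def)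
  qed
  moreover have "length pre < k \<and> ?ys ! length pre \<in> rel_ideal (As2_rels arr) (?ns ! length pre)"
    using y assms by (auto simp: words_def nth_append)
  ultimately show ?thesis unfolding kos_null_def by (intro fv.span_base) blast
qed

text \<open>Telescoping over the entries; in the induction \<open>pre\<close> collects those already
  replaced.\<close>

lemma emb_nfs_in_kos_null:
  "pre @ xs \<in> words k n \<Longrightarrow>
    emb (pre @ xs) - emb (pre @ nfs xs) \<in> (kos_null (As2_rels arr) k n :: (_ \<Rightarrow>\<^sub>0 'k::field) set)"
proof (induction xs arbitrary: pre)
  case Nil
  show ?case unfolding kos_null_def by (simp add: fv.span_zero)
next
  case (Cons x xs)
  obtain t a where x: "x = (t, a)" by fastforce
  have "(pre @ [(nf t, a)]) @ xs \<in> words k n" using Cons.prems by (simp add: x words_def)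
  note Cons.IH[OF this]
  moreover have "emb (pre @ (t, a) # xs) - emb (pre @ (nf t, a) # xs)
      \<in> (kos_null (As2_rels arr) k n :: (_ \<Rightarrow>\<^sub>0 'k) set)"
    using emb_nf_in_kos_null Cons.prems x by blast
  ultimately have "(emb (pre @ (t, a) # xs) - emb (pre @ (nf t, a) # xs)) +
     (emb ((pre @ [(nf t, a)]) @ xs) - emb ((pre @ [(nf t, a)]) @ nfs xs))
      \<in> (kos_null (As2_rels arr) k n :: (_ \<Rightarrow>\<^sub>0 'k) set)"
    unfolding kos_null_def by (intro fv.span_add)
  then show ?case by (simp add: x)
qed

lemma kos_null_As2:
  "kos_null (As2_rels arr) k n = {z \<in> kos_chain (As2_rels arr) k n. nft z = (0 :: _ \<Rightarrow>\<^sub>0 'k::field)}"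
proof
  have "fv.subspace {z \<in> kos_chain (As2_rels arr) k n. nft z = (0 :: _ \<Rightarrow>\<^sub>0 'k)}"
    using fv.subspace_span[of "emb ` words k n :: (_ \<Rightarrow>\<^sub>0 'k) set"]
    unfolding kos_chain_As2 fv.subspace_def by (auto simp: nft_def lin_add lin_scale)
  then show "kos_null (As2_rels arr) k n \<subseteq> {z \<in> kos_chain (As2_rels arr) k n. nft z = (0 :: _ \<Rightarrow>\<^sub>0 'k)}"
    unfolding kos_null_def
  proof (rule fv.span_minimal[rotated], clarify)
    fix x :: "_ \<Rightarrow>\<^sub>0 'k" and ys :: "(('w \<times> 'w) tree \<Rightarrow>\<^sub>0 'k) list" and ns j
    assume *: "x \<in> koszul_dual (As2_rels arr) (length ns)" "list_all2 (\<lambda>y m. y \<in> free_op m) ys ns"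
      "j < length ns" "ys ! j \<in> rel_ideal (As2_rels arr) (ns ! j)"
    have "tensors x ys \<in> kos_chain (As2_rels arr) (length ns) (sum_list ns)"
      unfolding kos_chain_def using *(1,2) by (intro fv.span_base) blast
    moreover have "nft (tensors x ys) = 0"
      using *(2-4) by (intro nft_tensors_zero) (auto simp: rel_ideal_As2 list_all2_lengthD)
    ultimately show "tensors x ys \<in> kos_chain (As2_rels arr) (length ns) (sum_list ns) \<and> nft (tensors x ys) = 0" ..
  qed
  show "{z \<in> kos_chain (As2_rels arr) k n. nft z = (0 :: _ \<Rightarrow>\<^sub>0 'k)} \<subseteq> kos_null (As2_rels arr) k n"
  proof clarify
    fix z :: "_ \<Rightarrow>\<^sub>0 'k" assume z: "z \<in> kos_chain (As2_rels arr) k n" "nft z = 0"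
    then obtain b where b: "z = lin emb b" "keys b \<subseteq> words k n"
      unfolding kos_chain_As2 span_image_eq_lin by blast
    have "lin (\<lambda>xs. emb xs - emb (nfs xs)) b \<in> kos_null (As2_rels arr) k n"
      unfolding kos_null_def
      by (rule lin_in_subspace[OF fv.subspace_span])
        (use b(2) emb_nfs_in_kos_null[of "[]", unfolded kos_null_def] in auto)
    moreover have "lin (\<lambda>xs. emb (nfs xs)) b = 0"
      using z(2) unfolding b(1) by (simp add: nft_def lin_lin nft_emb[unfolded nft_def])
    ultimately show "z \<in> kos_null (As2_rels arr) k n" by (simp add: lin_diff_fun b(1))
  qed
qed


section \<open>The Koszul differential\<close>

definition kos_diff1 :: "('w \<times> 'w) tree \<times> ('w \<times> 'w) tree list \<Rightarrow>
    (('w \<times> 'w) tree \<times> ('w \<times> 'w) tree list \<Rightarrow>\<^sub>0 'k::field)" where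
  "kos_diff1 = (\<lambda>(c, fs). \<Sum>(c', i, e)\<in>top_splits c.
     Poly_Mapping.single
       (c', take (i - 1) fs @ \<langle>fs ! (i - 1), e, fs ! i\<rangle> # drop (i + 1) fs)
       ((- 1) ^ size c' * (- 1) ^ after c' i))"

lemma kos_diff_eq_lin: "kos_diff z = lin kos_diff1 z"
  unfolding kos_diff_def lin_def kos_diff1_def
  by (simp add: fv.scale_sum_right case_prod_unfold mult.commute)

lemma kos_diff_scale: "kos_diff (vscale a z) = vscale a (kos_diff z)"
  and nft_scale: "nft (vscale a z) = vscale a (nft z)"
  by (simp_all only: kos_diff_eq_lin nft_def lin_scale)

text \<open>\<open>lab_graft\<close> for a corolla: splitting off a top vertex corresponds to
  multiplying two neighbouring letters, which form its label.\<close>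

lemma lab_graft_corolla:
  assumes "length w = Suc (size1 c)" "i < size1 c"
  shows "lab (graft c (Suc i) (corolla e)) w \<longleftrightarrow> lab c (merge (\<cdot>) i w) \<and> e = (w ! i, w ! Suc i)"
proof -
  have w: "w = take i w @ [w ! i, w ! Suc i] @ drop (Suc (Suc i)) w"
    using assms by (simp add: Cons_nth_drop_Suc)
  have "lab (graft c (Suc (length (take i w))) (corolla e)) (take i w @ [w ! i, w ! Suc i] @ drop (Suc (Suc i)) w) \<longleftrightarrow>
      lab c (take i w @ wprod [w ! i, w ! Suc i] # drop (Suc (Suc i)) w) \<and> lab (corolla e) [w ! i, w ! Suc i]"
    using assms by (intro lab_graft) (simp_all add: corolla_def)
  moreover have "length (take i w) = i" using assms by simp
  ultimately show ?thesis
    using w by (simp add: merge_def corolla_def)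
qed

lemma map_snd_merge: "Suc i < length xs \<Longrightarrow> map snd (merge tprod i xs) = merge (\<cdot>) i (map snd xs)"
  by (cases "xs ! i"; cases "xs ! Suc i") (simp add: merge_def take_map drop_map)

lemma map_fst_merge:
  assumes "Suc i < length xs"
  shows "map fst (merge tprod i xs) = take i (map fst xs) @
    \<langle>map fst xs ! i, (map snd xs ! i, map snd xs ! Suc i), map fst xs ! Suc i\<rangle> # drop (Suc (Suc i)) (map fst xs)"
  using assms by (cases "xs ! i"; cases "xs ! Suc i") (simp add: merge_def take_map drop_map)

text \<open>A coherent tree with a top vertex split off amounts to a position \<open>i\<close> and a
  tree coherent with the word merged at \<open>i\<close>. The sign with \<open>after\<close> occurs
  in both \<open>kos_diff\<close> and \<open>tsign_graft\<close> and cancels;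
  \<open>size c' = k - 1\<close> gives the global sign and the position the alternating one.\<close>

lemma kos_diff_emb:
  assumes len: "length xs = Suc k"
  shows "kos_diff (emb xs) = vscale ((- 1) ^ Suc k) (lin emb (bar tprod xs) :: _ \<Rightarrow>\<^sub>0 'k::field)"
proof -
  define w fs where "w = map snd xs" and "fs = map fst xs"
  define F where "F c' i e = (c', take i fs @ \<langle>fs ! i, e, fs ! Suc i\<rangle> # drop (Suc (Suc i)) fs)"
    for c' :: "('w \<times> 'w) tree" and i e
  let ?S = "SIGMA c:{c. lab c w}. top_splits c"
  let ?T = "SIGMA i:{..<k}. {c. lab c (merge (\<cdot>) i w)}"
  have lw: "length w = Suc k" using len by (simp add: w_def)
  have S: "\<exists>j. i = Suc j \<and> j < k \<and> size1 c' = k \<and> lab c' (merge (\<cdot>) j w) \<and> e = (w ! j, w ! Suc j) \<and>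
      c = graft c' i (corolla e)" if "(c, (c', i, e)) \<in> ?S" for c c' i e
  proof -
    have *: "lab (graft c' i (corolla e)) w" "1 \<le> i" "i \<le> size1 c'" "c = graft c' i (corolla e)"
      using that by (auto simp: top_splits_def)
    have "size1 c' = k"
      using lab_length[OF *(1)] size1_graft[OF *(2,3), of "corolla e"] lw by (simp add: corolla_def)
    moreover obtain j where "i = Suc j" using *(2) by (cases i) auto
    ultimately show ?thesis using * lab_graft_corolla[of w c' j e] lw by auto
  qed
  have T: "(graft c' (Suc i) (corolla (w ! i, w ! Suc i)), (c', Suc i, (w ! i, w ! Suc i))) \<in> ?S"
    if "(i, c') \<in> ?T" for i c'
  proof -
    have "i < k" "lab c' (merge (\<cdot>) i w)" using that by auto
    moreover from this have "size1 c' = k" using lab_length[of c'] lw by (fastforce simp: merge_def)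
    ultimately show ?thesis using lab_graft_corolla[of w c' i] lw by (auto simp: top_splits_def)
  qed
  have "kos_diff (emb xs) = (\<Sum>c | lab c w. vscale (tsign c) (kos_diff1 (c, fs)) :: _ \<Rightarrow>\<^sub>0 'k)"
    by (simp add: kos_diff_eq_lin emb_eq_sum lin_sum w_def fs_def)
  also have "\<dots> = (\<Sum>c | lab c w. \<Sum>(c', i, e)\<in>top_splits c.
      Poly_Mapping.single (F c' (i - 1) e) (tsign c * (- 1) ^ size c' * (- 1) ^ after c' i))"
  proof (rule sum.cong[OF refl])
    fix c
    show "vscale (tsign c) (kos_diff1 (c, fs)) = (\<Sum>(c', i, e)\<in>top_splits c.
      Poly_Mapping.single (F c' (i - 1) e) (tsign c * (- 1) ^ size c' * (- 1 :: 'k) ^ after c' i))"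
      unfolding kos_diff1_def case_prod_unfold fst_conv snd_conv fv.scale_sum_right
    proof (rule sum.cong[OF refl])
      fix x assume "x \<in> top_splits c"
      then obtain j where "fst (snd x) = Suc j" by (cases "fst (snd x)") (auto simp: top_splits_def)
      then show "vscale (tsign c) (Poly_Mapping.single (fst x, take (fst (snd x) - 1) fs @
            \<langle>fs ! (fst (snd x) - 1), snd (snd x), fs ! fst (snd x)\<rangle> # drop (fst (snd x) + 1) fs)
            ((- 1) ^ size (fst x) * (- 1) ^ after (fst x) (fst (snd x)))) =
          Poly_Mapping.single (F (fst x) (fst (snd x) - 1) (snd (snd x)))
            (tsign c * (- 1) ^ size (fst x) * (- 1 :: 'k) ^ after (fst x) (fst (snd x)))"
        by (simp add: F_def mult.assoc)
    qed
  qed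
  also have "\<dots> = (\<Sum>(c, (c', i, e))\<in>?S.
      Poly_Mapping.single (F c' (i - 1) e) (tsign c * (- 1) ^ size c' * (- 1) ^ after c' i))"
    by (subst sum.Sigma[symmetric]) (auto simp: finite_lab finite_top_splits)
  also have "\<dots> = (\<Sum>(i, c')\<in>?T. Poly_Mapping.single (F c' i (w ! i, w ! Suc i)) ((- 1) ^ (Suc k + i) * tsign c'))"
  proof (rule sum.reindex_bij_witness[where
        i = "\<lambda>(i, c'). (graft c' (Suc i) (corolla (w ! i, w ! Suc i)), (c', Suc i, (w ! i, w ! Suc i)))" and
        j = "\<lambda>(c, (c', i, e)). (i - 1, c')"])
    fix a assume a: "a \<in> ?S"
    obtain c c' i e where a': "a = (c, (c', i, e))" by (metis surj_pair)
    obtain j where j: "i = Suc j" "j < k" "size1 c' = k" "lab c' (merge (\<cdot>) j w)" "e = (w ! j, w ! Suc j)"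
      "c = graft c' i (corolla e)" using S a a' by blast
    then show "(case case a of (c, c', i, e) \<Rightarrow> (i - 1, c') of
        (i, c') \<Rightarrow> (graft c' (Suc i) (corolla (w ! i, w ! Suc i)), c', Suc i, w ! i, w ! Suc i)) = a"
      and "(case a of (c, c', i, e) \<Rightarrow> (i - 1, c')) \<in> ?T" by (auto simp: a')
    \<comment> \<open>A corolla has one vertex, so the second exponent of \<open>tsign_graft\<close>
      is the zero-based position \<open>j = i - 1\<close>.\<close>
    have "tsign c = (- 1) ^ after c' i * (- 1) ^ j * (tsign c' :: 'k)"
      using tsign_graft[of i c' "corolla e"] j by (simp add: corolla_def)
    moreover have "Suc (size c') = k" using j(3) by (simp add: size1_size)
    moreover have "(- 1 :: 'k) ^ after c' i * ((- 1) ^ after c' i * x) = x" for x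
      by (simp add: mult.assoc[symmetric] power_mult_distrib[symmetric])
    ultimately have "tsign c * (- 1) ^ size c' * (- 1) ^ after c' i = (- 1) ^ (Suc k + j) * (tsign c' :: 'k)"
      by (auto simp: power_add mult_ac)
    then show "(case case a of (c, c', i, e) \<Rightarrow> (i - 1, c') of (i, c') \<Rightarrow>
        Poly_Mapping.single (F c' i (w ! i, w ! Suc i)) ((- 1) ^ (Suc k + i) * tsign c')) =
      (case a of (c, c', i, e) \<Rightarrow>
        Poly_Mapping.single (F c' (i - 1) e) (tsign c * (- 1) ^ size c' * (- 1 :: 'k) ^ after c' i))"
      using j by (simp add: a')
  next
    fix b assume b: "b \<in> ?T"
    obtain i c' where b': "b = (i, c')" by fastforce
    show "(case case b of (i, c') \<Rightarrow> (graft c' (Suc i) (corolla (w ! i, w ! Suc i)), c', Suc i, w ! i, w ! Suc i) of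
        (c, c', i, e) \<Rightarrow> (i - 1, c')) = b" by (simp add: b')
    show "(case b of (i, c') \<Rightarrow> (graft c' (Suc i) (corolla (w ! i, w ! Suc i)), c', Suc i, w ! i, w ! Suc i)) \<in> ?S"
      using T b unfolding b' by simp
  qed
  also have "\<dots> = (\<Sum>i<k. \<Sum>c' | lab c' (merge (\<cdot>) i w).
      Poly_Mapping.single (F c' i (w ! i, w ! Suc i)) ((- 1) ^ (Suc k + i) * tsign c'))"
    by (subst sum.Sigma) (auto simp: finite_lab)
  also have "\<dots> = (\<Sum>i<k. vscale ((- 1) ^ (Suc k + i)) (emb (merge tprod i xs)))"
  proof (rule sum.cong[OF refl])
    fix i assume "i \<in> {..<k}"
    then have i: "Suc i < length xs" using len by simp
    show "(\<Sum>c' | lab c' (merge (\<cdot>) i w).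
      Poly_Mapping.single (F c' i (w ! i, w ! Suc i)) ((- 1) ^ (Suc k + i) * tsign c')) =
      vscale ((- 1 :: 'k) ^ (Suc k + i)) (emb (merge tprod i xs))"
      unfolding emb_eq_sum map_snd_merge[OF i] map_fst_merge[OF i] F_def w_def fs_def
      by (simp add: fv.scale_sum_right)
  qed
  also have "\<dots> = vscale ((- 1) ^ Suc k) (lin emb (bar tprod xs))"
    by (simp only: bar_eq_sum lin_sum lin_scale len fv.scale_sum_right fv.scale_scale power_add lin_single
        fv.scale_one diff_Suc_1)
  finally show ?thesis .
qed

lemma emb_singleton: "emb [(t, a)] = sng (\<langle>\<rangle>, [t])"
  by (simp add: emb_eq_sum lab_singleton)

section \<open>Lists modulo normal forms\<close>

lemma keys_bar_words:
  assumes f: "\<And>x y. size1 (fst (f x y)) = size1 (fst x) + size1 (fst (y :: ('w \<times> 'w) tree \<times> 'w))"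
    and b: "keys b \<subseteq> words (Suc k) n"
  shows "keys (lin (bar f) b :: _ \<Rightarrow>\<^sub>0 'k::field) \<subseteq> words k n"
proof
  fix ys assume "ys \<in> keys (lin (bar f) b)"
  then obtain xs where xs: "xs \<in> keys b" "ys \<in> keys (bar f xs :: _ \<Rightarrow>\<^sub>0 'k)" using keys_lin[of "bar f" b] by blast
  then show "ys \<in> words k n" using keys_bar[OF xs(2), of "\<lambda>x. size1 (fst x)"] f b by (auto simp: words_def)
qed

lemma kos_diff_lin_emb:
  assumes "keys b \<subseteq> words (Suc k) n"
  shows "kos_diff (lin emb b) = vscale ((- 1) ^ Suc k) (lin emb (lin (bar tprod) b))"
proof -
  have "kos_diff (lin emb b) = lin (\<lambda>xs. kos_diff (emb xs)) b"
    by (simp add: kos_diff_eq_lin lin_lin)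
  also have "\<dots> = lin (\<lambda>xs. vscale ((- 1) ^ Suc k) (lin emb (bar tprod xs))) b"
    by (rule lin_cong, rule kos_diff_emb) (use assms in \<open>auto simp: words_def\<close>)
  finally show ?thesis by (simp only: lin_scale_fun lin_lin)
qed

definition nfsl :: "((('w \<times> 'w) tree \<times> 'w) list \<Rightarrow>\<^sub>0 'k::field) \<Rightarrow> ((('w \<times> 'w) tree \<times> 'w) list \<Rightarrow>\<^sub>0 'k)" where
  "nfsl = lin (\<lambda>xs. sng (nfs xs))"

lemma nft_lin_emb: "nft (lin emb b) = lin emb (nfsl b)"
  unfolding nft_def nfsl_def lin_lin lin_single fv.scale_one
  by (rule lin_cong) (simp add: nft_emb[unfolded nft_def])

lemma nfsl_bar: "nfsl (lin (bar tprod) b) = lin (bar nprod) (nfsl b)"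
  unfolding nfsl_def lin_lin lin_single fv.scale_one nfs_bar ..

lemma keys_nfsl: "keys b \<subseteq> words k n \<Longrightarrow> keys (nfsl b) \<subseteq> words k n"
proof -
  assume b: "keys b \<subseteq> words k n"
  have "keys (nfsl b) \<subseteq> nfs ` keys b"
    unfolding nfsl_def using keys_lin[of "\<lambda>xs. sng (nfs xs)" b] by auto
  moreover have "nfs xs \<in> words k n" if "xs \<in> words k n" for xs
    using that by (auto simp: words_def comp_def)
  ultimately show ?thesis using b by blast
qed

definition all_normal :: "(('w \<times> 'w) tree \<times> 'w) list \<Rightarrow> bool" where
  "all_normal xs \<longleftrightarrow> (\<forall>x\<in>set xs. normal (fst x))"

lemma all_normal_nfsl: "xs \<in> keys (nfsl b) \<Longrightarrow> all_normal xs"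
proof -
  assume "xs \<in> keys (nfsl b)"
  then obtain ys where "xs = nfs ys" unfolding nfsl_def using keys_lin[of "\<lambda>xs. sng (nfs xs)" b] by auto
  then show ?thesis by (simp add: all_normal_def)
qed

lemma nfsl_all_normal: "(\<And>xs. xs \<in> keys b \<Longrightarrow> all_normal xs) \<Longrightarrow> nfsl b = b"
proof -
  assume *: "\<And>xs. xs \<in> keys b \<Longrightarrow> all_normal xs"
  have "nfsl b = lin sng b"
    unfolding nfsl_def
  proof (rule lin_cong)
    fix xs assume xs: "xs \<in> keys b"
    have "nfs xs = xs"
    proof (rule map_idI)
      fix x assume "x \<in> set xs"
      then have "normal (fst x)" using *[OF xs] by (simp add: all_normal_def)
      then show "apfst nf x = x" by (cases x) (simp add: nf_normal)
    qed
    then show "sng (nfs xs) = sng xs" by simp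
  qed
  then show ?thesis by simp
qed

section \<open>The contracting homotopy\<close>

text \<open>The algebra with product \<open>nprod\<close> is free on the pairs \<open>(t, \<alpha>)\<close> with \<open>\<not> reducible t \<alpha>\<close>:
  if \<open>\<langle>l, (a, b), r\<rangle>\<close> is normal then \<open>(\<langle>l, (a, b), r\<rangle>, a \<cdot> b)\<close> is uniquely the product of the generator
  \<open>(l, a)\<close> and of \<open>(r, b)\<close>.  Lists of length 1 stand for elements of the operad itself, where
  the second component is forgotten.\<close>

fun htpy :: "(('w \<times> 'w) tree \<times> 'w) list \<Rightarrow> ((('w \<times> 'w) tree \<times> 'w) list \<Rightarrow>\<^sub>0 'k::field)" where
  "htpy ((\<langle>l, (a, b), r\<rangle>, c) # xs) = (if c = a \<cdot> b \<or> xs = [] then sng ((l, a) # (r, b) # xs) else 0)"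
| "htpy _ = 0"

lemma keys_htpy:
  assumes "xs \<in> words k n" "ys \<in> keys (htpy xs :: _ \<Rightarrow>\<^sub>0 'k::field)"
  shows "ys \<in> words (Suc k) n" and "all_normal xs \<Longrightarrow> all_normal ys"
  using assms by (induction xs rule: htpy.induct; auto simp: words_def all_normal_def split: if_splits)+

text \<open>If the first entry is a proper product, \<open>htpy\<close> splits off its first
  generator and the terms other than the list itself cancel. If it is a generator,
  \<open>htpy\<close> kills the list but recovers it from the term in which the first two entries
  are multiplied.\<close>

lemma bar_htpy:
  assumes "all_normal (x # y # zs)"
  shows "lin (bar nprod) (htpy (x # y # zs)) + lin htpy (bar nprod (x # y # zs)) =
    (sng (x # y # zs) :: _ \<Rightarrow>\<^sub>0 'k::field)"
proof -
  obtain t c s d where x: "x = (t, c)" and y: "y = (s, d)" by fastforce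
  have ne: "l \<noteq> []" if "l \<in> keys (bar nprod (y # zs) :: _ \<Rightarrow>\<^sub>0 'k)" for l
    using keys_bar[OF that, of "\<lambda>_. 0"] by auto
  show ?thesis
  proof (cases "reducible t c")
    case True
    then obtain l a b r where t: "t = \<langle>l, (a, b), r\<rangle>" "c = a \<cdot> b" by (cases "(t, c)" rule: reducible.cases) auto
    have "\<not> reducible l a" using assms by (simp add: all_normal_def x t)
    then have m: "mul l (a, b) r = t" by (simp add: mul_eq_Node t)
    let ?B = "bar nprod (y # zs) :: _ \<Rightarrow>\<^sub>0 'k"
    \<comment> \<open>Terms that do not merge \<open>x\<close> still begin with it, so they are
      split in the same way.\<close>
    have "lin (\<lambda>l. htpy (x # l)) ?B = lin (\<lambda>ys. sng ((l, a) # (r, b) # ys)) ?B"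
      by (rule lin_cong) (simp add: x t)
    then show ?thesis
      by (simp add: x y t lin_minus lin_lin assoc m[unfolded t])
  next
    case False
    have h0: "htpy (x # l) = (0 :: _ \<Rightarrow>\<^sub>0 'k)" if "l \<noteq> []" for l
      using False that by (cases t) (auto simp: x)
    then have "lin (\<lambda>l. htpy (x # l)) (bar nprod (y # zs) :: _ \<Rightarrow>\<^sub>0 'k) = 0"
      using ne by (intro lin_zero_fun) blast
    then show ?thesis using h0[of "y # zs"] False
      by (simp add: x y lin_minus lin_lin mul_eq_Node)
  qed
qed

text \<open>The splitting disregards the letter \<open>c\<close>, so multiplying back restores the
  entry only up to its letter, which \<open>emb\<close> forgets.\<close>

lemma bar_htpy_single:
  assumes "all_normal [x]" "size1 (fst x) \<ge> 2"
  shows "lin emb (lin (bar nprod) (htpy [x])) = emb [x]"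
proof -
  obtain l a b r c where x: "x = (\<langle>l, (a, b), r\<rangle>, c)"
    using assms(2) by (cases x; cases "fst x") auto
  have "\<not> reducible l a" using assms by (simp add: all_normal_def x)
  then have "lin emb (lin (bar nprod) (htpy [x])) = emb [(\<langle>l, (a, b), r\<rangle>, a \<cdot> b)]"
    by (simp add: x mul_eq_Node)
  also have "\<dots> = emb [x]" by (simp add: emb_singleton x)
  finally show ?thesis .
qed

text \<open>The coordinate at the right comb of a word, together with the list of trees, isolates
  one list, since a comb with a vertex has only one leaf word.\<close>

lemma emb_inj:
  assumes "keys b \<subseteq> words k n" "k \<ge> 2" "lin emb b = (0 :: _ \<Rightarrow>\<^sub>0 'k::field)"
  shows "b = 0"
proof (rule poly_mapping_eqI)
  fix xs
  show "lookup b xs = lookup 0 xs"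
  proof (cases "xs \<in> keys b")
    case True
    then have len: "length xs = k" using assms(1) by (auto simp: words_def)
    let ?w = "map snd xs"
    have lw: "lab (comb ?w) ?w" using len assms(2) by (intro lab_comb) auto
    have "comb ?w \<noteq> \<langle>\<rangle>" using lab_length[OF lw] len assms(2) by auto
    then have "map fst ys = map fst xs \<and> lab (comb ?w) (map snd ys) \<longleftrightarrow> ys = xs" for ys
      using lw lab_unique[OF _ lw] by (metis zip_map_fst_snd)
    then have "lookup (lin emb b) (comb ?w, map fst xs) = (\<Sum>ys\<in>keys b. if ys = xs then lookup b xs * tsign (comb ?w) else 0)"
      unfolding lookup_lin by (intro sum.cong refl) (simp add: lookup_emb)
    then show ?thesis using True assms(3) by simp
  qed (simp add: in_keys_iff)
qed

text \<open>This makes the homotopy well defined on chains: \<open>emb\<close> is injective except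
  on single entries, and there \<open>htpy\<close> does not look at the letter.\<close>

lemma htpy_emb_kernel:
  assumes "keys b \<subseteq> words k n" "k \<ge> 1" "lin emb b = (0 :: _ \<Rightarrow>\<^sub>0 'k::field)"
  shows "lin htpy b = (0 :: _ \<Rightarrow>\<^sub>0 'k)"
proof (cases "k = 1")
  case True
  \<comment> \<open>The homotopy on single trees, with \<open>undefined\<close> standing for the
    forgotten letter.\<close>
  define g :: "('w \<times> 'w) tree \<times> ('w \<times> 'w) tree list \<Rightarrow> ((('w \<times> 'w) tree \<times> 'w) list \<Rightarrow>\<^sub>0 'k)"
    where "g = (\<lambda>(c, fs). htpy [(hd fs, undefined)])"
  have "htpy xs = lin g (emb xs)" if xs: "xs \<in> keys b" for xs
  proof -
    have "length xs = 1" using xs assms(1) True by (auto simp: words_def)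
    then obtain t a where xs: "xs = [(t, a)]" by (auto simp: length_Suc_conv)
    have "htpy [(t, a)] = (htpy [(t, undefined)] :: _ \<Rightarrow>\<^sub>0 'k)"
      by (cases "[(t, a)]" rule: htpy.cases) auto
    then show ?thesis by (simp add: xs emb_singleton g_def)
  qed
  then have "lin htpy b = lin g (lin emb b)" unfolding lin_lin by (rule lin_cong)
  then show ?thesis using assms(3) by simp
next
  case False
  then have "b = 0" using assms by (intro emb_inj[of b k n]) auto
  then show ?thesis by simp
qed

lemma keys_lin_htpy:
  assumes "keys b \<subseteq> words k n"
  shows "keys (lin htpy b :: _ \<Rightarrow>\<^sub>0 'k::field) \<subseteq> words (Suc k) n"
    and "(\<And>xs. xs \<in> keys b \<Longrightarrow> all_normal xs) \<Longrightarrow> ys \<in> keys (lin htpy b :: _ \<Rightarrow>\<^sub>0 'k) \<Longrightarrow> all_normal ys"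
  using keys_lin[of htpy b] keys_htpy assms by blast+

text \<open>In degree 0 every tree has a root to split because \<open>n\<close> is at least 2. In
  positive degree \<open>bar_htpy\<close> applies, and the homotopy of the boundary vanishes even
  when that boundary is zero only after \<open>emb\<close>.\<close>

lemma boundary_of_cycle:
  fixes b :: "(('w \<times> 'w) tree \<times> 'w) list \<Rightarrow>\<^sub>0 'k::field"
  assumes n: "n \<ge> 2" and b: "keys b \<subseteq> words (Suc k) n" and norm: "\<And>xs. xs \<in> keys b \<Longrightarrow> all_normal xs"
    and cycle: "k \<ge> 1 \<Longrightarrow> lin emb (lin (bar nprod) b) = 0"
  shows "lin emb (lin (bar nprod) (lin htpy b)) = lin emb b"
proof (cases "k = 0")
  case True
  show ?thesis
    unfolding lin_lin
  proof (rule lin_cong)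
    fix xs assume xs: "xs \<in> keys b"
    then have "length xs = 1" using b True by (auto simp: words_def)
    then obtain x where x: "xs = [x]" by (auto simp: length_Suc_conv)
    have "size1 (fst x) \<ge> 2" using xs b n by (auto simp: words_def x)
    then show "lin (\<lambda>a. lin emb (bar nprod a)) (htpy xs) = emb xs"
      using bar_htpy_single[of x] norm[OF xs] by (simp add: x lin_lin)
  qed
next
  case False
  have "lin htpy (lin (bar nprod) b) = 0"
    by (rule htpy_emb_kernel[OF keys_bar_words[OF size1_nprod b]]) (use False cycle in auto)
  moreover have "lin (bar nprod) (lin htpy b) + lin htpy (lin (bar nprod) b) = lin sng b"
    unfolding lin_lin lin_add_fun[symmetric]
  proof (rule lin_cong)
    fix xs assume xs: "xs \<in> keys b"
    then have "length xs \<ge> 2" using b False by (auto simp: words_def)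
    then obtain x y zs where "xs = x # y # zs" by (metis Suc_le_length_iff numeral_2_eq_2)
    then show "lin (bar nprod) (htpy xs) + lin htpy (bar nprod xs) = sng xs"
      using bar_htpy norm[OF xs] by blast
  qed
  ultimately show ?thesis by simp
qed

theorem koszul_As2: "koszul (As2_rels arr :: (_ \<Rightarrow>\<^sub>0 'k::field) set)"
  unfolding koszul_def
proof (intro allI impI)
  fix n k :: nat assume n: "2 \<le> n" and k: "1 \<le> k"
  let ?R = "As2_rels arr :: (_ \<Rightarrow>\<^sub>0 'k) set"
  obtain m where m: "k = Suc m" using k by (cases k) auto
  have chainE: "\<exists>b. z = lin emb b \<and> keys b \<subseteq> words j n" if "z \<in> kos_chain ?R j n" for z j
    using that unfolding kos_chain_As2 span_image_eq_lin by blast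
  have chainI: "lin emb b \<in> kos_chain ?R j n" if "keys b \<subseteq> words j n" for b j
    using that unfolding kos_chain_As2 span_image_eq_lin by blast
  have chain: "fv.subspace (kos_chain ?R j n)" for j
    unfolding kos_chain_As2 by simp
  have nft_diff: "nft (kos_diff (lin emb b)) =
      vscale ((- 1) ^ Suc j) (lin emb (lin (bar nprod) (nfsl b)) :: _ \<Rightarrow>\<^sub>0 'k)"
    if "keys b \<subseteq> words (Suc j) n" for b j
    unfolding kos_diff_lin_emb[OF that]
    by (simp only: nfsl_bar[symmetric] nft_lin_emb[symmetric]) (simp only: nft_scale)
  have diff_chain: "kos_diff z \<in> kos_chain ?R j n" if z: "z \<in> kos_chain ?R (Suc j) n" for z j
  proof -
    obtain b where b: "z = lin emb b" "keys b \<subseteq> words (Suc j) n" using chainE[OF z] by blast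
    show ?thesis
      unfolding b(1) kos_diff_lin_emb[OF b(2)]
      by (intro fv.subspace_scale[OF chain] chainI keys_bar_words[OF size1_tprod b(2)])
  qed
  have sign: "(- 1 :: 'k) ^ j \<noteq> 0" for j by simp
  show "{z \<in> kos_chain ?R k n. kos_diff z \<in> kos_null ?R (k - 1) n} =
     {kos_diff y + w | y w. y \<in> kos_chain ?R (k + 1) n \<and> w \<in> kos_null ?R k n}"
  proof (intro equalityI subsetI)
    fix z assume "z \<in> {z \<in> kos_chain ?R k n. kos_diff z \<in> kos_null ?R (k - 1) n}"
    then have z: "z \<in> kos_chain ?R (Suc m) n" "kos_diff z \<in> kos_null ?R m n" by (simp_all add: m)
    obtain b where b: "z = lin emb b" "keys b \<subseteq> words (Suc m) n" using chainE[OF z(1)] by blast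
    let ?b = "nfsl b" and ?h = "lin htpy (nfsl b) :: _ \<Rightarrow>\<^sub>0 'k"
    have b': "keys ?b \<subseteq> words (Suc m) n" by (rule keys_nfsl[OF b(2)])
    have cycle: "lin emb (lin (bar nprod) ?b) = (0 :: _ \<Rightarrow>\<^sub>0 'k)"
      using z(2) nft_diff[OF b(2)] unfolding b(1) kos_null_As2 by simp
    have bd: "lin emb (lin (bar nprod) ?h) = lin emb ?b"
      by (rule boundary_of_cycle[OF n b' all_normal_nfsl cycle])
    have h: "keys ?h \<subseteq> words (Suc k) n" unfolding m by (rule keys_lin_htpy[OF b'])
    have nh: "nfsl ?h = ?h" by (rule nfsl_all_normal) (rule keys_lin_htpy(2)[OF b' all_normal_nfsl])
    \<comment> \<open>The sign undoes the one by which \<open>kos_diff\<close> differs from the bar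
      differential.\<close>
    define y where "y = vscale ((- 1) ^ Suc k) (lin emb ?h)"
    have y: "y \<in> kos_chain ?R (k + 1) n"
      unfolding y_def by (intro fv.subspace_scale[OF chain]) (simp add: chainI h)
    have "kos_diff y = vscale ((- 1) ^ Suc k) (kos_diff (lin emb ?h))"
      by (simp only: y_def kos_diff_scale)
    then have "nft (kos_diff y) = vscale ((- 1) ^ Suc k) (nft (kos_diff (lin emb ?h)))"
      by (simp only: nft_scale)
    also have "\<dots> = lin emb ?b"
      unfolding nft_diff[OF h] nh bd by (simp add: power_mult_distrib[symmetric])
    also have "\<dots> = nft z" unfolding b(1) nft_lin_emb ..
    \<comment> \<open>\<open>z\<close> and the boundary of \<open>y\<close> have the same normal
      form, so their difference is the null chain \<open>w\<close> sought.\<close>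
    finally have "nft (z - kos_diff y) = 0" by (simp add: nft_def lin_minus)
    moreover have "kos_diff y \<in> kos_chain ?R k n" using y diff_chain by simp
    then have "z - kos_diff y \<in> kos_chain ?R k n" using z(1) m by (intro fv.subspace_diff[OF chain]) simp_all
    ultimately have "z - kos_diff y \<in> kos_null ?R k n" unfolding kos_null_As2 by simp
    moreover have "z = kos_diff y + (z - kos_diff y)" by simp
    ultimately show "z \<in> {kos_diff y + w | y w. y \<in> kos_chain ?R (k + 1) n \<and> w \<in> kos_null ?R k n}"
      using y by blast
  next
    fix z assume "z \<in> {kos_diff y + w | y w. y \<in> kos_chain ?R (k + 1) n \<and> w \<in> kos_null ?R k n}"
    then obtain y w where z: "z = kos_diff y + w" "y \<in> kos_chain ?R (Suc k) n"
      and w: "w \<in> kos_chain ?R k n" "nft w = 0" unfolding kos_null_As2 by auto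
    have dy: "kos_diff y \<in> kos_chain ?R k n" by (rule diff_chain[OF z(2)])
    then have zc: "z \<in> kos_chain ?R k n" unfolding z(1) using w(1) by (rule fv.subspace_add[OF chain])
    obtain c where c: "y = lin emb c" "keys c \<subseteq> words (Suc k) n" using chainE[OF z(2)] by blast
    obtain b where b: "w = lin emb b" "keys b \<subseteq> words k n" using chainE[OF w(1)] by blast
    let ?c = "lin (bar tprod) c :: _ \<Rightarrow>\<^sub>0 'k"
    have c': "keys ?c \<subseteq> words (Suc m) n" using keys_bar_words[OF size1_tprod c(2)] m by simp
    \<comment> \<open>The square of the differential is zero modulo null chains: after normalisation
      it is the square of the bar differential of the associative \<open>nprod\<close>.\<close>
    have "nft (kos_diff (lin emb ?c)) = 0"
      unfolding nft_diff[OF c'] nfsl_bar by (simp add: lin_lin bar_bar[OF nprod_assoc] lin_zero_fun)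
    then have "nft (kos_diff (kos_diff y)) = 0"
      unfolding c(1) kos_diff_lin_emb[OF c(2)] kos_diff_scale nft_scale by simp
    \<comment> \<open>The differential preserves null chains: in degree 0 there is nothing to
      multiply, and in positive degree injectivity of \<open>emb\<close> makes the normalised
      combination of lists itself zero.\<close>
    moreover have "nft (kos_diff w) = 0"
    proof (cases "m = 0")
      case True
      have "bar nprod xs = (0 :: _ \<Rightarrow>\<^sub>0 'k)" if "xs \<in> keys (nfsl b)" for xs
      proof -
        have "length xs = 1" using that keys_nfsl[OF b(2)] True m by (auto simp: words_def)
        then show ?thesis by (auto simp: length_Suc_conv)
      qed
      then have "lin (bar nprod) (nfsl b) = (0 :: _ \<Rightarrow>\<^sub>0 'k)" by (rule lin_zero_fun)
      then show ?thesis using nft_diff[of b m] b m by simp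
    next
      case False
      have "nfsl b = 0"
        by (rule emb_inj[OF keys_nfsl[OF b(2)]]) (use False m w(2) in \<open>simp_all add: b(1) nft_lin_emb\<close>)
      then show ?thesis using nft_diff[of b m] b m by simp
    qed
    ultimately have "nft (kos_diff z) = 0"
      unfolding z(1) by (simp add: nft_def kos_diff_eq_lin lin_add)
    moreover have "kos_diff z \<in> kos_chain ?R m n" using zc diff_chain m by simp
    ultimately have "kos_diff z \<in> kos_null ?R (k - 1) n" unfolding kos_null_As2 using m by simp
    then show "z \<in> {z \<in> kos_chain ?R k n. kos_diff z \<in> kos_null ?R (k - 1) n}" using zc by simp
  qed
qed

end

theorem proposition1p3:
  fixes arr :: "'w::finite \<Rightarrow> 'w \<Rightarrow> 'w"
    and R :: "(('w \<times> 'w) tree \<Rightarrow>\<^sub>0 'k::field) set"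
    and \<omega> :: nat and p :: "nat \<Rightarrow> nat" and P :: "rat fps"
  assumes "semigroup arr"
  defines "R \<equiv> As2_rels arr"
    and "\<omega> \<equiv> card (UNIV :: 'w set)"
    and "p \<equiv> operad_dim R"
    and "P \<equiv> Abs_fps (\<lambda>n. if n = 0 then 0 else of_nat (p n))"
  shows "koszul R \<and>
    p 1 = 1 \<and>
    (\<forall>n\<ge>2. p n = \<omega> * (\<omega> - 1) * (\<Sum>k=1..n-1. p k * p (n - k)) + \<omega> * p (n - 1)) \<and>
    (\<omega> \<ge> 2 \<longrightarrow>
      P = (1 - fps_const (of_nat \<omega>) * fps_X
             - fps_sqrt (1 + fps_const (2 * of_nat \<omega> * (1 - 2 * of_nat \<omega>)) * fps_X
                           + fps_const ((of_nat \<omega>)\<^sup>2) * fps_X\<^sup>2))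
          / fps_const (2 * of_nat \<omega> * (of_nat \<omega> - 1)))"
proof -
  interpret two_param arr using assms(1) by (rule two_param.intro)
  have p: "p n = card (normals n)" for n
    unfolding p_def R_def by (rule operad_dim_As2)
  have p1: "p 1 = 1" unfolding p normals_1 by simp
  have rec: "p n = \<omega> * (\<omega> - 1) * (\<Sum>k=1..n-1. p k * p (n - k)) + \<omega> * p (n - 1)" if "n \<ge> 2" for n
    unfolding p \<omega>_def by (rule card_normals_rec[OF that])
  show ?thesis
    using koszul_As2 p1 rec quadratic_recursion_fps[of p \<omega>, OF p1 _ rec] unfolding R_def P_def by blast
qed

end
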